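(* Let $F$ be a field, let $K=F(X_1,\dots,X_n)$ be the rational function field in $n$ indeterminates over $F$, and let $\sigma$ be an $F$-automorphism of $K$ of infinite order that extends an $F$-automorphism of the polynomial algebra $F[X_1,\dots,X_n]$. Then the division algebra $K(X;\sigma)$ contains a noncommutative free (associative) $F$-subalgebra.
   Context: $K[X;\sigma]$ denotes the skew polynomial ring in an indeterminate $X$ over $K$, with elements written with coefficients on the left and multiplication determined by $X\alpha=\sigma(\alpha)X$ for all $\alpha\in K$; $K(X;\sigma)$ denotes its (Ore) division ring of fractions. A noncommutative free algebra is a free associative algebra on at least two free generators. *)

theory Defs
  imports
    "HOL-Library.Poly_Mapping"
    "HOL-Computational_Algebra.Polynomial_Factorial"
    "HOL-Algebra.Embedded_Algebras"
    "HOL-Algebra.Algebraic_Closure_Type"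
begin

section \<open>Polynomials and rational functions over a field\<close>

text \<open>
  The indeterminates are indexed by a type. A finite index type with n elements gives n
  indeterminates. The linear order on the index type serves only to obtain the library's
  instance of class \<^class>\<open>idom\<close>.
\<close>

type_synonym ('n, 'f) polynomials = "('n \<Rightarrow>\<^sub>0 nat) \<Rightarrow>\<^sub>0 'f"
type_synonym ('n, 'f) rat_functions = "(('n \<Rightarrow>\<^sub>0 nat) \<Rightarrow>\<^sub>0 'f) fract"

definition poly_const :: "'f \<Rightarrow> ('n::linorder, 'f::field) polynomials"
  where "poly_const c = Poly_Mapping.single 0 c"

definition rat_const :: "'f \<Rightarrow> ('n::linorder, 'f::field) rat_functions"
  where "rat_const c = to_fract (poly_const c)"

text \<open>The automorphisms of the commutative algebra with structure map \<open>\<iota>\<close>.\<close>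

definition algebra_automorphisms :: "('f \<Rightarrow> 'a::comm_ring_1) \<Rightarrow> ('a \<Rightarrow> 'a) set"
  where "algebra_automorphisms \<iota> =
    {\<sigma> \<in> ring_iso ring_of_type_algebra ring_of_type_algebra. \<forall>c. \<sigma> (\<iota> c) = \<iota> c}"

definition infinite_order :: "('a \<Rightarrow> 'a) \<Rightarrow> bool"
  where "infinite_order \<sigma> \<longleftrightarrow> (\<forall>m>0. \<sigma> ^^ m \<noteq> id)"


section \<open>Skew polynomial rings\<close>

text \<open>
  The additive group of the skew polynomial ring is that of ordinary polynomials, with
  coefficients written on the left. The relation \<open>X \<alpha> = \<sigma>(\<alpha>) X\<close> forces
  \<open>(a X\<^sup>i) (b X\<^sup>j) = a \<sigma>\<^sup>i(b) X\<^sup>i\<^sup>+\<^sup>j\<close>.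
\<close>

definition skew_mult :: "('k \<Rightarrow> 'k) \<Rightarrow> 'k::field poly \<Rightarrow> 'k poly \<Rightarrow> 'k poly"
  where "skew_mult \<sigma> p q =
    (\<Sum>i\<le>degree p. \<Sum>j\<le>degree q.
       Polynomial.monom (poly.coeff p i * (\<sigma> ^^ i) (poly.coeff q j)) (i + j))"

definition skew_poly_ring :: "('k \<Rightarrow> 'k) \<Rightarrow> 'k::field poly ring"
  where "skew_poly_ring \<sigma> =
    \<lparr>carrier = UNIV, monoid.mult = skew_mult \<sigma>, one = 1, ring.zero = 0, add = (+)\<rparr>"

lemma skew_mult_X_const:
  assumes "\<sigma> 0 = 0"
  shows "skew_mult \<sigma> (Polynomial.monom 1 1) [:\<alpha>:] = skew_mult \<sigma> [:\<sigma> \<alpha>:] (Polynomial.monom 1 1)"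
    (is "?l = ?r")
proof -
  have "?l = Polynomial.monom (\<sigma> \<alpha>) 1"
    by (simp add: skew_mult_def degree_monom_eq assms)
  moreover have "?r = Polynomial.monom (\<sigma> \<alpha>) 1"
    by (simp add: skew_mult_def degree_monom_eq)
  ultimately show ?thesis by simp
qed


section \<open>Division rings of fractions\<close>

text \<open>
  \<open>D\<close>, together with the embedding \<open>\<phi>\<close> of \<open>R\<close>, is an Ore division ring of fractions: every
  element is a left fraction \<open>s\<^sup>-\<^sup>1 a\<close>. Such a \<open>D\<close> is unique up to a unique isomorphism over \<open>R\<close>.
  When \<open>\<sigma>\<close> is an automorphism, the skew polynomial ring is Ore on both sides, so left and right
  fractions give the same division ring.
\<close>

definition division_ring_of_fractions ::
    "('r, 'm) ring_scheme \<Rightarrow> ('d, 'e) ring_scheme \<Rightarrow> ('r \<Rightarrow> 'd) \<Rightarrow> bool"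
  where "division_ring_of_fractions R D \<phi> \<longleftrightarrow>
    ring D \<and> Units D = carrier D - {\<zero>\<^bsub>D\<^esub>} \<and>
    \<phi> \<in> ring_hom R D \<and> inj_on \<phi> (carrier R) \<and>
    (\<forall>d\<in>carrier D. \<exists>a\<in>carrier R. \<exists>s\<in>carrier R - {\<zero>\<^bsub>R\<^esub>}. d = inv\<^bsub>D\<^esub> (\<phi> s) \<otimes>\<^bsub>D\<^esub> \<phi> a)"


section \<open>Free associative algebras\<close>

text \<open>The algebra of the free monoid of words (lists) over the alphabet \<open>S\<close>.\<close>

definition free_mult :: "('x list \<Rightarrow>\<^sub>0 'f::field) \<Rightarrow> ('x list \<Rightarrow>\<^sub>0 'f) \<Rightarrow> ('x list \<Rightarrow>\<^sub>0 'f)"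
  where "free_mult p q =
    (\<Sum>u\<in>Poly_Mapping.keys p. \<Sum>v\<in>Poly_Mapping.keys q.
       Poly_Mapping.single (u @ v) (Poly_Mapping.lookup p u * Poly_Mapping.lookup q v))"

definition free_algebra :: "'x set \<Rightarrow> ('x list \<Rightarrow>\<^sub>0 'f::field) ring"
  where "free_algebra S =
    \<lparr>carrier = {p. Poly_Mapping.keys p \<subseteq> lists S}, monoid.mult = free_mult,
     one = Poly_Mapping.single [] 1, ring.zero = 0, add = (+)\<rparr>"

text \<open>
  \<open>A\<close> is a unital subalgebra of \<open>D\<close>, whose structure map is \<open>\<iota>\<close>, and is isomorphic as an algebra
  to a free algebra on at least two generators. Taking the alphabet inside the type of elements
  of \<open>D\<close> is no restriction, because the free generators of \<open>A\<close> are themselves elements of \<open>D\<close>.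
\<close>

definition noncommutative_free_subalgebra ::
    "('f::field \<Rightarrow> 'd) \<Rightarrow> 'd set \<Rightarrow> ('d, 'e) ring_scheme \<Rightarrow> bool"
  where "noncommutative_free_subalgebra \<iota> A D \<longleftrightarrow>
    subring A D \<and> subalgebra (range \<iota>) A D \<and>
    (\<exists>(S :: 'd set) h. (\<exists>x\<in>S. \<exists>y\<in>S. x \<noteq> y) \<and>
       h \<in> ring_iso (free_algebra S) (D\<lparr>carrier := A\<rparr>) \<and>
       (\<forall>c::'f. h (Poly_Mapping.single [] c) = \<iota> c))"

end

theory Submission
  imports Defs
begin

text \<open>
  Write \<open>\<eta> = (1 - X)\<^sup>-\<^sup>1\<close> and let \<open>E\<close> be the fixed field of \<open>\<sigma>\<close> in \<open>K\<close>. If \<open>a\<close> and \<open>b\<close> are linearly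
  independent over \<open>E\<close> modulo the image of \<open>\<sigma> - 1\<close>, then \<open>a \<eta>\<close> and \<open>b \<eta>\<close> are free generators: the
  words \<open>\<eta> s\<^sub>1 \<eta> \<dots> s\<^sub>m \<eta>\<close> are left linearly independent over \<open>K\<close> modulo the skew polynomials, because
  \<open>X \<eta> = \<eta> - 1\<close> turns a relation \<open>r\<close> into a smaller one, namely \<open>X r - r\<close>. Suitable elements are
  \<open>1 / P\<close> and \<open>1 / P\<^sup>2\<close> for a prime \<open>P\<close> of the polynomial algebra whose orbit is infinite up to
  associates: nonzero elements of \<open>E\<close> are units at every prime of the orbit, while \<open>\<sigma> u - u\<close> cannot have
  exactly one pole along the orbit. Such a \<open>P\<close> is found among the \<open>X\<^sub>i\<close> and \<open>X\<^sub>i + 1\<close>, since otherwise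
  some power of \<open>\<sigma>\<close> fixes all \<open>X\<^sub>i\<close>.
\<close>

section \<open>Evaluation of polynomials\<close>

text \<open>Every element is the finite sum of its terms, so an additive claim need only be checked
  on single terms.\<close>

lemma poly_mapping_induct_add [case_names zero single add]:
  fixes p :: "'a \<Rightarrow>\<^sub>0 'b::comm_monoid_add"
  assumes zero: "P 0"
    and single: "\<And>k c. P (Poly_Mapping.single k c)"
    and add: "\<And>p q. P p \<Longrightarrow> P q \<Longrightarrow> P (p + q)"
  shows "P p"
proof -
  have "P (\<Sum>k\<in>A. Poly_Mapping.single k (Poly_Mapping.lookup p k))" if "finite A" for A
    using that by induction (simp_all add: assms)
  moreover have "p = (\<Sum>k\<in>Poly_Mapping.keys p. Poly_Mapping.single k (Poly_Mapping.lookup p k))"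
    by (rule poly_mapping_eqI)
      (auto simp: lookup_sum lookup_single when_def sum.delta in_keys_iff)
  ultimately show ?thesis
    by (metis finite_keys)
qed

text \<open>Three embeddings of scalars are covered at once: into the polynomial algebra, into
  polynomials in one more variable over it, and into the rational function field.\<close>

locale coefficient_hom =
  fixes C :: "'f::field \<Rightarrow> 'r::comm_ring_1"
  assumes C_zero: "C 0 = 0" and C_one: "C 1 = 1"
    and C_add: "C (a + b) = C a + C b" and C_mult: "C (a * b) = C a * C b"
begin

definition eval_poly :: "('n::{finite,linorder} \<Rightarrow> 'r) \<Rightarrow> ('n, 'f) polynomials \<Rightarrow> 'r" where
  "eval_poly g p = (\<Sum>m\<in>Poly_Mapping.keys p. C (Poly_Mapping.lookup p m) *
     (\<Prod>i\<in>UNIV. g i ^ Poly_Mapping.lookup m i))"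

lemma eval_poly_superset:
  assumes "finite A" "Poly_Mapping.keys p \<subseteq> A"
  shows "eval_poly g p = (\<Sum>m\<in>A. C (Poly_Mapping.lookup p m) *
     (\<Prod>i\<in>UNIV. g i ^ Poly_Mapping.lookup m i))"
  unfolding eval_poly_def
  by (rule sum.mono_neutral_left) (use assms in \<open>auto simp: in_keys_iff C_zero\<close>)

lemma eval_poly_zero [simp]: "eval_poly g 0 = 0"
  by (simp add: eval_poly_def)

lemma eval_poly_add: "eval_poly g (p + q) = eval_poly g p + eval_poly g q"
proof -
  let ?A = "Poly_Mapping.keys p \<union> Poly_Mapping.keys q"
  have "Poly_Mapping.keys (p + q) \<subseteq> ?A"
    by (rule Poly_Mapping.keys_add)
  then show ?thesis
    by (simp add: eval_poly_superset[of ?A] lookup_add C_add distrib_right sum.distrib)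
qed

lemma eval_poly_single:
  "eval_poly g (Poly_Mapping.single m c) = C c * (\<Prod>i\<in>UNIV. g i ^ Poly_Mapping.lookup m i)"
  by (subst eval_poly_superset[of "{m}"]) simp_all

lemma eval_poly_const: "eval_poly g (poly_const c) = C c"
  by (simp add: poly_const_def eval_poly_single)

text \<open>Both sides are additive in \<open>p\<close> and in \<open>q\<close>, which leaves
  products of two monomials.\<close>

lemma eval_poly_mult: "eval_poly g (p * q) = eval_poly g p * eval_poly g q"
proof (induction p rule: poly_mapping_induct_add)
  case (single m c)
  show ?case
  proof (induction q rule: poly_mapping_induct_add)
    case (single m' c')
    show ?case
      by (simp add: mult_single eval_poly_single C_mult lookup_add power_add prod.distrib)
  qed (simp_all add: eval_poly_add distrib_left)
qed (simp_all add: eval_poly_add distrib_right)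

end

definition indeterminate :: "'n::linorder \<Rightarrow> ('n, 'f::field) polynomials" where
  "indeterminate i = Poly_Mapping.single (Poly_Mapping.single i 1) 1"

lemma (in coefficient_hom) eval_poly_indeterminate: "eval_poly g (indeterminate i) = g i"
proof -
  have "(\<Prod>j\<in>UNIV. g j ^ (1 when i = j)) = (\<Prod>j\<in>UNIV. if j = i then g i else 1)"
    by (intro prod.cong) (auto simp: when_def)
  then show ?thesis
    by (simp add: indeterminate_def eval_poly_single lookup_single C_one)
qed

lemma poly_const_simps:
  "poly_const 0 = 0" "poly_const 1 = 1"
  "poly_const (a + b) = poly_const a + poly_const b"
  "poly_const (a * b) = poly_const a * poly_const b"
  by (simp_all add: poly_const_def single_add mult_single)

lemma single_power_one:
  "Poly_Mapping.single m (1::'f::field) ^ k = Poly_Mapping.single (\<Sum>_<k. m) 1"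
  for m :: "'n::linorder \<Rightarrow>\<^sub>0 nat"
  by (induction k) (simp_all add: mult_single add.commute)

text \<open>Terms written through ring operations allow a ring homomorphism to be computed from its
  values on constants and indeterminates.\<close>

lemma single_eq_monomial:
  fixes m :: "'n::{finite,linorder} \<Rightarrow>\<^sub>0 nat"
  shows "Poly_Mapping.single m (c::'f::field) =
    poly_const c * (\<Prod>i\<in>UNIV. indeterminate i ^ Poly_Mapping.lookup m i)"
proof -
  have "(\<Prod>i\<in>A. indeterminate i ^ Poly_Mapping.lookup m i :: ('n, 'f) polynomials) =
      Poly_Mapping.single (\<Sum>i\<in>A. \<Sum>_<Poly_Mapping.lookup m i. Poly_Mapping.single i 1) 1"
    if "finite A" for A
    using that by induction (simp_all add: indeterminate_def single_power_one mult_single)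
  moreover have "(\<Sum>i\<in>UNIV. \<Sum>_<Poly_Mapping.lookup m i. Poly_Mapping.single i 1) = m"
    by (rule poly_mapping_eqI) (simp add: lookup_sum lookup_single when_def if_distrib cong: if_cong)
  ultimately show ?thesis
    by (simp add: poly_const_def mult_single)
qed

interpretation self_eval: coefficient_hom "poly_const :: 'f::field \<Rightarrow> ('n::linorder, 'f) polynomials"
  by unfold_locales (rule poly_const_simps)+

text \<open>Substituting \<open>X\<^sub>i T\<close> for \<open>X\<^sub>i\<close> collects the homogeneous components of a polynomial, so the
  additivity of the total degree is inherited from univariate polynomials.\<close>

interpretation graded_eval: coefficient_hom
  "\<lambda>c::'f::field. [:poly_const c :: ('n::linorder, 'f) polynomials:]"
  by unfold_locales (simp_all add: poly_const_simps)

definition graded :: "('n::{finite,linorder}, 'f::field) polynomials \<Rightarrow> ('n, 'f) polynomials poly"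
  where "graded = graded_eval.eval_poly (\<lambda>i. Polynomial.monom (indeterminate i) 1)"

definition total_degree :: "('n::{finite,linorder}, 'f::field) polynomials \<Rightarrow> nat"
  where "total_degree p = Polynomial.degree (graded p)"

lemma graded_mult: "graded (p * q) = graded p * graded q"
  by (simp add: graded_def graded_eval.eval_poly_mult)

text \<open>Putting \<open>T = 1\<close> undoes the substitution of \<open>X\<^sub>i T\<close>; in
  particular \<open>graded\<close> is injective.\<close>

lemma poly_graded_1: "poly (graded p) 1 = p"
proof (induction p rule: poly_mapping_induct_add)
  case (single m c)
  show ?case
    by (simp add: graded_def graded_eval.eval_poly_single poly_prod poly_monom flip: single_eq_monomial)
qed (simp_all add: graded_def graded_eval.eval_poly_add)

text \<open>At \<open>T = 0\<close> every monomial of positive degree disappears.\<close>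

lemma poly_graded_0: "poly (graded p) 0 = poly_const (Poly_Mapping.lookup p 0)"
proof (induction p rule: poly_mapping_induct_add)
  case (single m c)
  show ?case
  proof (cases "m = 0")
    case True
    then show ?thesis
      by (simp add: graded_def graded_eval.eval_poly_single poly_prod)
  next
    case False
    then obtain i where "Poly_Mapping.lookup m i \<noteq> 0"
      by (metis lookup_zero poly_mapping_eqI)
    then have "(\<Prod>i\<in>UNIV. poly (Polynomial.monom (indeterminate i) 1) 0 ^ Poly_Mapping.lookup m i) =
      (0::('a, 'b) polynomials)"
      by (intro prod_zero bexI[of _ i]) (simp_all add: poly_monom)
    with False show ?thesis
      by (simp add: graded_def graded_eval.eval_poly_single poly_prod lookup_single poly_const_simps)
  qed
qed (simp_all add: graded_def graded_eval.eval_poly_add lookup_add poly_const_simps)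

lemma graded_eq_0_iff: "graded p = 0 \<longleftrightarrow> p = 0"
  by (metis graded_def graded_eval.eval_poly_zero poly_0 poly_graded_1)

lemma total_degree_mult:
  "p \<noteq> 0 \<Longrightarrow> q \<noteq> 0 \<Longrightarrow> total_degree (p * q) = total_degree p + total_degree q"
  by (simp add: total_degree_def graded_mult degree_mult_eq graded_eq_0_iff)

text \<open>A polynomial that is constant in \<open>T\<close> has the same value at
  \<open>1\<close>, where it is \<open>p\<close>, and at \<open>0\<close>, where it is the constant
  term of \<open>p\<close>.\<close>

lemma total_degree_eq_0D:
  assumes "total_degree p = 0"
  shows "p = poly_const (Poly_Mapping.lookup p 0)"
proof -
  obtain a where "graded p = [:a:]"
    using assms by (auto simp: total_degree_def elim: degree_eq_zeroE)
  then have "p = poly (graded p) 0"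
    using poly_graded_1[of p] by simp
  then show ?thesis by (simp add: poly_graded_0)
qed

lemma total_degree_one: "total_degree 1 = 0"
  using total_degree_mult[of 1 1] by simp

lemma poly_const_dvd_1: "c \<noteq> 0 \<Longrightarrow> poly_const c dvd 1"
  by (rule dvdI[of _ _ "poly_const (inverse c)"]) (simp flip: poly_const_simps)

lemma dvd_1_imp_const:
  fixes p :: "('n::{finite,linorder}, 'f::field) polynomials"
  assumes "p dvd 1"
  obtains c where "p = poly_const c"
proof -
  from assms obtain q where q: "1 = p * q" by (auto elim: dvdE)
  then have "p \<noteq> 0" "q \<noteq> 0" by auto
  with q have "total_degree p + total_degree q = 0"
    by (metis total_degree_mult total_degree_one)
  then show ?thesis using total_degree_eq_0D that by blast
qed

lemma total_degree_pos:
  assumes "p \<noteq> 0" "\<not> p dvd 1"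
  shows "total_degree p > 0"
proof (rule ccontr)
  assume "\<not> ?thesis"
  then obtain c where "p = poly_const c" using total_degree_eq_0D by blast
  with assms show False by (cases "c = 0") (simp_all add: poly_const_simps poly_const_dvd_1)
qed

section \<open>Prime divisors of a polynomial\<close>

lemma prime_elem_dvd_prod:
  assumes "finite I" "prime_elem p" "p dvd (\<Prod>i\<in>I. f i)"
  shows "\<exists>i\<in>I. p dvd f i"
  using assms by (induction I) (auto simp: prime_elem_dvd_mult_iff dest: prime_elem_not_unit)

text \<open>The primes are split off one at a time: \<open>Q i\<close> divides none of those already
  removed, hence it divides the remaining cofactor.\<close>

lemma prod_primes_dvd:
  fixes Q :: "'i \<Rightarrow> 'a::idom"
  assumes "finite I" "\<And>i. i \<in> I \<Longrightarrow> prime_elem (Q i)"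
    and "\<And>i j. i \<in> I \<Longrightarrow> j \<in> I \<Longrightarrow> i \<noteq> j \<Longrightarrow> \<not> Q i dvd Q j"
    and "\<And>i. i \<in> I \<Longrightarrow> Q i dvd q"
  shows "(\<Prod>i\<in>I. Q i) dvd q"
  using assms
proof (induction I)
  case (insert i I)
  then have "(\<Prod>i\<in>I. Q i) dvd q" by auto
  then obtain r where r: "q = (\<Prod>i\<in>I. Q i) * r" by (rule dvdE)
  have "prime_elem (Q i)" using insert.prems by simp
  moreover have "\<not> Q i dvd (\<Prod>i\<in>I. Q i)"
    using \<open>finite I\<close> \<open>i \<notin> I\<close> insert.prems calculation
    by (metis insertCI prime_elem_dvd_prod)
  moreover have "Q i dvd (\<Prod>i\<in>I. Q i) * r" using insert.prems r by auto
  ultimately have "Q i dvd r" by (simp add: prime_elem_dvd_mult_iff)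
  then show ?case using insert.hyps by (simp add: r mult.commute mult_dvd_mono)
qed simp

text \<open>The product of \<open>k\<close> such divisors divides \<open>q\<close> and has total
  degree at least \<open>k\<close>, because each prime has positive degree. So there are at most
  \<open>total_degree q\<close> of them.\<close>

lemma finite_prime_divisors:
  fixes Q :: "'i \<Rightarrow> ('n::{finite,linorder}, 'f::field) polynomials"
  assumes "\<And>i. prime_elem (Q i)" "\<And>i j. i \<noteq> j \<Longrightarrow> \<not> Q i dvd Q j" "q \<noteq> 0"
  shows "finite {i. Q i dvd q}"
proof (rule ccontr)
  assume "infinite {i. Q i dvd q}"
  then obtain I where I: "I \<subseteq> {i. Q i dvd q}" "finite I" "card I = Suc (total_degree q)"
    by (metis infinite_arbitrarily_large)
  have "(\<Prod>i\<in>I. Q i) dvd q"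
    by (rule prod_primes_dvd) (use I assms in auto)
  then obtain r where r: "q = (\<Prod>i\<in>I. Q i) * r" by (rule dvdE)
  have "card I \<le> total_degree (\<Prod>i\<in>I. Q i)"
    using \<open>finite I\<close>
  proof induction
    case (insert i I)
    have "Q i \<noteq> 0" for i
      using assms(1) by (auto simp: prime_elem_def)
    moreover from this have "total_degree (Q i) > 0" "(\<Prod>i\<in>I. Q i) \<noteq> 0"
      using assms(1) insert.hyps
      by (auto simp: prime_elem_not_unit intro!: total_degree_pos)
    ultimately show ?case using insert by (simp add: total_degree_mult)
  qed simp
  also have "\<dots> \<le> total_degree q"
    using \<open>q \<noteq> 0\<close> r by (simp add: total_degree_mult)
  finally show False using I by simp
qed

section \<open>Primes with infinite orbit\<close>

text \<open>Evaluation at \<open>X\<^sub>i = - c\<close> maps into a domain, and its kernel consists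
  of the multiples of \<open>X\<^sub>i + c\<close>.\<close>

lemma prime_elem_indeterminate_add_const:
  fixes i :: "'n::{finite,linorder}" and c :: "'f::field"
  shows "prime_elem (indeterminate i + poly_const c)" (is "prime_elem ?P")
proof -
  define g where "g = (indeterminate :: 'n \<Rightarrow> ('n, 'f) polynomials)(i := poly_const (- c))"
  let ?e = "self_eval.eval_poly g"
  \<comment> \<open>Modulo \<open>?P\<close> each indeterminate agrees with its substituted value,
    so monomials do as well.\<close>
  have cong: "?P dvd (\<Prod>j\<in>A. indeterminate j ^ k j) - (\<Prod>j\<in>A. g j ^ k j)" if "finite A" for A k
    using that
  proof induction
    case (insert j A)
    have "?P dvd indeterminate j - g j"
      by (auto simp: g_def poly_const_def single_uminus)
    then have "?P dvd indeterminate j ^ k j - g j ^ k j"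
      by (metis dvd_mult2 power_diff_sumr2)
    then have "?P dvd (indeterminate j ^ k j - g j ^ k j) * (\<Prod>j\<in>A. indeterminate j ^ k j) +
      g j ^ k j * ((\<Prod>j\<in>A. indeterminate j ^ k j) - (\<Prod>j\<in>A. g j ^ k j))"
      using insert.IH by (intro dvd_add) auto
    then show ?case using insert.hyps by (simp add: algebra_simps)
  qed simp
  have diff: "?P dvd p - ?e p" for p
  proof (induction p rule: poly_mapping_induct_add)
    case (single m a)
    have "?P dvd poly_const a * ((\<Prod>j\<in>UNIV. indeterminate j ^ Poly_Mapping.lookup m j) -
      (\<Prod>j\<in>UNIV. g j ^ Poly_Mapping.lookup m j))"
      by (intro dvd_mult cong) simp
    then show ?case
      by (simp add: self_eval.eval_poly_single right_diff_distrib flip: single_eq_monomial)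
  next
    case (add p q)
    then show ?case
      using dvd_add[OF add] by (simp add: self_eval.eval_poly_add algebra_simps)
  qed simp
  have "?e ?P = poly_const (- c + c)"
    by (simp add: self_eval.eval_poly_add self_eval.eval_poly_indeterminate
        self_eval.eval_poly_const g_def flip: poly_const_simps(3))
  then have "?e ?P = 0" by (simp add: poly_const_simps)
  then have dvd_iff: "?P dvd p \<longleftrightarrow> ?e p = 0" for p
    using diff[of p] by (auto simp: self_eval.eval_poly_mult elim!: dvdE)
  have "?P \<noteq> 0"
  proof
    assume "?P = 0"
    then have "Poly_Mapping.lookup ?P (Poly_Mapping.single i 1) = 0" by simp
    moreover have "Poly_Mapping.single i (1::nat) \<noteq> 0"
      by (metis lookup_single_eq lookup_zero zero_neq_one)
    ultimately show False
      by (simp add: lookup_add indeterminate_def poly_const_def lookup_single when_def)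
  qed
  moreover have "?e 1 = 1"
    using self_eval.eval_poly_const[of g 1] by (simp add: poly_const_simps)
  ultimately show ?thesis
    by (auto simp: prime_elem_def dvd_iff self_eval.eval_poly_mult)
qed

section \<open>Automorphisms of commutative rings\<close>

locale ring_automorphism =
  fixes \<tau> :: "'a::comm_ring_1 \<Rightarrow> 'a"
  assumes hom_add: "\<tau> (a + b) = \<tau> a + \<tau> b" and hom_mult: "\<tau> (a * b) = \<tau> a * \<tau> b"
    and hom_one: "\<tau> 1 = 1" and bij: "bij \<tau>"
begin

lemma hom_zero: "\<tau> 0 = 0"
  using hom_add[of 0 0] by simp

lemma hom_minus: "\<tau> (- a) = - \<tau> a"
  using hom_add[of a "- a"] hom_zero by (simp add: eq_neg_iff_add_eq_0 add.commute)

lemma hom_eq_iff: "\<tau> a = \<tau> b \<longleftrightarrow> a = b"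
  using bij by (simp add: bij_is_inj inj_eq)

lemma hom_eq_0_iff: "\<tau> a = 0 \<longleftrightarrow> a = 0"
  using hom_eq_iff[of a 0] by (simp add: hom_zero)

lemma ex_preimage: "\<exists>a. b = \<tau> a"
  using bij by (meson bij_pointE)

lemma hom_dvd_iff: "\<tau> a dvd \<tau> b \<longleftrightarrow> a dvd b"
proof
  assume "\<tau> a dvd \<tau> b"
  then obtain c where "\<tau> b = \<tau> a * c" by (rule dvdE)
  moreover obtain d where "c = \<tau> d" using ex_preimage by blast
  ultimately show "a dvd b" by (simp add: hom_eq_iff flip: hom_mult)
qed (auto simp: dvd_def hom_mult)

lemma hom_dvd_1_iff: "\<tau> a dvd 1 \<longleftrightarrow> a dvd 1"
  using hom_dvd_iff[of a 1] by (simp add: hom_one)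

lemma prime_elem_hom:
  assumes "prime_elem p"
  shows "prime_elem (\<tau> p)"
proof (rule prime_elemI)
  show "\<tau> p \<noteq> 0" "\<not> \<tau> p dvd 1"
    using assms by (auto simp: hom_eq_0_iff hom_dvd_1_iff prime_elem_not_unit)
  fix a b assume "\<tau> p dvd a * b"
  moreover obtain c d where "a = \<tau> c" "b = \<tau> d" using ex_preimage by blast
  ultimately show "\<tau> p dvd a \<or> \<tau> p dvd b"
    using assms by (simp add: hom_dvd_iff prime_elem_dvd_mult_iff flip: hom_mult)
qed

lemma ring_automorphism_inv: "ring_automorphism (inv_into UNIV \<tau>)"
proof
  show "bij (inv_into UNIV \<tau>)" using bij by (rule bij_imp_bij_inv)
  show "inv_into UNIV \<tau> 1 = 1" using bij hom_one by (metis bij_inv_eq_iff)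
  show "inv_into UNIV \<tau> (a + b) = inv_into UNIV \<tau> a + inv_into UNIV \<tau> b"
    "inv_into UNIV \<tau> (a * b) = inv_into UNIV \<tau> a * inv_into UNIV \<tau> b" for a b
    using bij hom_add hom_mult by (metis bij_inv_eq_iff)+
qed

lemma ring_automorphism_funpow: "ring_automorphism (\<tau> ^^ n)"
proof (induction n)
  case (Suc n)
  then interpret n: ring_automorphism "\<tau> ^^ n" .
  show ?case
    using bij_comp[OF n.bij bij]
    by unfold_locales
      (simp_all add: hom_add hom_mult hom_one n.hom_add n.hom_mult n.hom_one comp_def)
qed (unfold_locales, auto simp: bij_id[unfolded id_def])

end

lemma algebra_automorphismsD:
  assumes "\<sigma> \<in> algebra_automorphisms \<iota>"
  shows "ring_automorphism \<sigma>" "\<sigma> (\<iota> c) = \<iota> c"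
  using assms
  by (auto simp: algebra_automorphisms_def ring_iso_def ring_hom_def ring_of_type_algebra_def
      ring_automorphism_def)

section \<open>Regularity of fractions at a prime\<close>

lemma prime_elem_not_dvd_mult:
  "prime_elem p \<Longrightarrow> \<not> p dvd a \<Longrightarrow> \<not> p dvd b \<Longrightarrow> \<not> p dvd a * b"
  by (simp add: prime_elem_dvd_mult_iff)

text \<open>\<open>p * r\<close> divides one of its own factors; cancelling yields
  \<open>r dvd 1\<close> or the excluded \<open>p dvd 1\<close>.\<close>

lemma prime_elem_mult_imp_unit:
  fixes p r :: "'a::idom"
  assumes "prime_elem (p * r)" "\<not> p dvd 1"
  shows "r dvd 1"
proof -
  have nz: "p \<noteq> 0" "r \<noteq> 0" using assms(1) by auto
  have "p * r dvd p \<or> p * r dvd r"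
    using assms(1) by (meson dvd_refl prime_elem_dvd_multD)
  then show ?thesis
  proof
    assume "p * r dvd p"
    then have "p * r dvd p * 1" by simp
    then show ?thesis using nz by (simp only: dvd_mult_cancel_left) simp
  next
    assume "p * r dvd r"
    then have "p * r dvd 1 * r" by simp
    then show ?thesis using nz assms(2) by (simp only: dvd_mult_cancel_right) simp
  qed
qed

text \<open>For prime \<open>p\<close> this is the localization at the ideal generated by
  \<open>p\<close>; the fractions outside it are those with a pole at \<open>p\<close>.\<close>

definition local_fracts :: "'a::idom \<Rightarrow> 'a fract set" where
  "local_fracts p = {to_fract a / to_fract b | a b. \<not> p dvd b}"

lemma to_fract_in_local_fracts: "prime_elem p \<Longrightarrow> to_fract a \<in> local_fracts p"
  unfolding local_fracts_def mem_Collect_eq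
  by (intro exI[of _ a] exI[of _ 1]) (simp add: prime_elem_not_unit)

lemma local_fracts_add:
  assumes "prime_elem p" "x \<in> local_fracts p" "y \<in> local_fracts p"
  shows "x + y \<in> local_fracts p"
proof -
  obtain a b c d where "x = to_fract a / to_fract b" "\<not> p dvd b" "y = to_fract c / to_fract d"
    "\<not> p dvd d"
    using assms by (auto simp: local_fracts_def)
  moreover from this have "to_fract b \<noteq> 0" "to_fract d \<noteq> 0" by auto
  moreover from calculation have "x + y = to_fract (a * d + c * b) / to_fract (b * d)"
    by (simp add: add_frac_eq)
  ultimately show ?thesis
    using assms(1) prime_elem_not_dvd_mult unfolding local_fracts_def by blast
qed

lemma local_fracts_mult:
  assumes "prime_elem p" "x \<in> local_fracts p" "y \<in> local_fracts p"
  shows "x * y \<in> local_fracts p"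
proof -
  obtain a b c d where "x = to_fract a / to_fract b" "\<not> p dvd b" "y = to_fract c / to_fract d"
    "\<not> p dvd d"
    using assms by (auto simp: local_fracts_def)
  moreover from this have "x * y = to_fract (a * c) / to_fract (b * d)" by simp
  ultimately show ?thesis
    using assms(1) prime_elem_not_dvd_mult unfolding local_fracts_def by blast
qed

lemma local_fracts_minus: "prime_elem p \<Longrightarrow> x \<in> local_fracts p \<Longrightarrow> - x \<in> local_fracts p"
  using local_fracts_mult[of p "to_fract (- 1)" x] to_fract_in_local_fracts[of p "- 1"] by simp

lemma local_fracts_diff:
  "prime_elem p \<Longrightarrow> x \<in> local_fracts p \<Longrightarrow> y \<in> local_fracts p \<Longrightarrow> x - y \<in> local_fracts p"
  using local_fracts_add[of p x "- y"] local_fracts_minus[of p y] by simp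

lemma inverse_in_local_fracts: "\<not> p dvd b \<Longrightarrow> inverse (to_fract b) \<in> local_fracts p"
  unfolding local_fracts_def mem_Collect_eq
  by (intro exI[of _ 1] exI[of _ b]) (simp add: divide_inverse)

lemma inverse_prime_notin_local_fracts:
  assumes "prime_elem p"
  shows "inverse (to_fract p) \<notin> local_fracts p"
proof
  assume "inverse (to_fract p) \<in> local_fracts p"
  then obtain a b where ab: "inverse (to_fract p) = to_fract a / to_fract b" "\<not> p dvd b"
    by (auto simp: local_fracts_def)
  moreover have "p \<noteq> 0" using assms by auto
  moreover from ab have "b \<noteq> 0" by auto
  ultimately have "to_fract b = to_fract (p * a)" by (simp add: field_simps)
  then have "b = p * a" by (simp only: to_fract_eq_iff)
  with ab show False by simp
qed

section \<open>Poles along a two-sided orbit of primes\<close>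

lemma ex_fract: obtains a b where "x = to_fract a / to_fract b" "b \<noteq> 0"
  by (cases x) (auto simp: Fract_conv_to_fract)

text \<open>Only the link between \<open>- 1\<close> and \<open>0\<close> is missing. A member
  \<open>j \<ge> 0\<close> still forces all larger integers into \<open>J\<close>, and a negative
  member all smaller ones; both contradict finiteness.\<close>

lemma shift_invariant_eq_empty:
  assumes "finite J" and "\<And>j::int. j \<noteq> 0 \<Longrightarrow> j \<in> J \<longleftrightarrow> j - 1 \<in> J"
  shows "J = {}"
proof (rule ccontr)
  assume "J \<noteq> {}"
  then obtain j where "j \<in> J" by blast
  show False
  proof (cases "j \<ge> 0")
    case True
    have "i \<in> J" if "j \<le> i" for i
      using that
    proof (induction rule: int_ge_induct)
      case (step i)
      then show ?case using True assms(2)[of "i + 1"] by simp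
    qed (rule \<open>j \<in> J\<close>)
    then have "{j..} \<subseteq> J" by auto
    then show False using \<open>finite J\<close> by (meson finite_subset infinite_Ici)
  next
    case False
    have "i \<in> J" if "i \<le> j" for i
      using that
    proof (induction rule: int_le_induct)
      case (step i)
      then show ?case using False assms(2)[of i] by simp
    qed (rule \<open>j \<in> J\<close>)
    then have "{..j} \<subseteq> J" by auto
    then show False using \<open>finite J\<close> by (meson finite_subset infinite_Iic)
  qed
qed

text \<open>Indexing by all integers allows poles to be followed in both directions.
  \<open>Q_0_not_dvd\<close> makes \<open>1 / Q 0\<close> regular at every other prime of the orbit,
  and \<open>finite_divisors\<close> leaves each fraction finitely many poles.\<close>

locale prime_orbit = ring_automorphism \<sigma> for \<sigma> :: "'a::idom fract \<Rightarrow> 'a fract" +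
  fixes \<tau> :: "'a \<Rightarrow> 'a" and Q :: "int \<Rightarrow> 'a"
  assumes \<tau>: "ring_automorphism \<tau>"
    and \<sigma>_to_fract: "\<sigma> (to_fract a) = to_fract (\<tau> a)"
    and prime: "prime_elem (Q j)"
    and shift: "\<tau> (Q j) = Q (j + 1)"
    and Q_0_not_dvd: "j \<noteq> 0 \<Longrightarrow> \<not> Q j dvd Q 0"
    and finite_divisors: "a \<noteq> 0 \<Longrightarrow> finite {j. Q j dvd a}"
begin

lemma hom_divide_to_fract: "\<sigma> (to_fract a / to_fract b) = to_fract (\<tau> a) / to_fract (\<tau> b)"
proof (cases "b = 0")
  case True
  then show ?thesis using \<sigma>_to_fract[of 0] by (simp add: hom_zero)
next
  case False
  then have "\<sigma> (to_fract a / to_fract b) * \<sigma> (to_fract b) = \<sigma> (to_fract a)"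
    by (simp flip: hom_mult)
  moreover have "to_fract (\<tau> b) \<noteq> 0"
    using False hom_eq_0_iff[of "to_fract b"] by (simp flip: \<sigma>_to_fract)
  ultimately show ?thesis by (simp add: \<sigma>_to_fract nonzero_eq_divide_eq)
qed

lemma hom_in_local_fracts_iff: "\<sigma> x \<in> local_fracts (Q (j + 1)) \<longleftrightarrow> x \<in> local_fracts (Q j)"
proof
  interpret \<tau>: ring_automorphism \<tau> by (rule \<tau>)
  show "\<sigma> x \<in> local_fracts (Q (j + 1))" if "x \<in> local_fracts (Q j)"
    using that unfolding local_fracts_def
    by (auto simp: hom_divide_to_fract simp flip: shift) (metis \<tau>.hom_dvd_iff)
  assume "\<sigma> x \<in> local_fracts (Q (j + 1))"
  then obtain a b where "\<sigma> x = to_fract (\<tau> a) / to_fract (\<tau> b)" "\<not> Q j dvd b"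
    unfolding local_fracts_def by (auto simp flip: shift) (metis \<tau>.ex_preimage \<tau>.hom_dvd_iff)
  then show "x \<in> local_fracts (Q j)"
    by (auto simp: local_fracts_def hom_eq_iff simp flip: hom_divide_to_fract)
qed

lemma finite_poles: "finite {j. x \<notin> local_fracts (Q j)}"
proof -
  obtain a b where x: "x = to_fract a / to_fract b" "b \<noteq> 0" by (rule ex_fract)
  have "{j. x \<notin> local_fracts (Q j)} \<subseteq> {j. Q j dvd b}"
    using x by (auto simp: local_fracts_def)
  then show ?thesis using finite_divisors[OF x(2)] by (rule finite_subset)
qed

text \<open>Since \<open>\<sigma>\<close> moves each pole to the next prime, the poles of a fixed
  element are invariant under the whole shift; being finite in number, there are none.\<close>

lemma fixed_in_local_fracts:
  assumes "\<sigma> e = e"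
  shows "e \<in> local_fracts (Q j)"
proof -
  have "{j. e \<notin> local_fracts (Q j)} = {}"
    using finite_poles
  proof (rule shift_invariant_eq_empty)
    show "j \<in> {j. e \<notin> local_fracts (Q j)} \<longleftrightarrow> j - 1 \<in> {j. e \<notin> local_fracts (Q j)}" for j
      using hom_in_local_fracts_iff[of e "j - 1"] assms by simp
  qed
  then show ?thesis by auto
qed

text \<open>The only poles of \<open>w\<close> along the orbit are at \<open>Q 0\<close>, whereas a nonempty finite set of poles of
  \<open>u\<close> yields at least two poles of \<open>\<sigma> u - u\<close>.\<close>

lemma cohomologous_to_zero_regular:
  assumes "\<sigma> u - u = w" and "\<And>j. j \<noteq> 0 \<Longrightarrow> w \<in> local_fracts (Q j)"
  shows "w \<in> local_fracts (Q 0)"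
proof -
  have "j \<in> {j. u \<notin> local_fracts (Q j)} \<longleftrightarrow> j - 1 \<in> {j. u \<notin> local_fracts (Q j)}" if "j \<noteq> 0" for j
  proof -
    have "u \<in> local_fracts (Q j) \<longleftrightarrow> \<sigma> u \<in> local_fracts (Q j)"
    proof
      assume "u \<in> local_fracts (Q j)"
      then have "u + w \<in> local_fracts (Q j)"
        using assms(2)[OF that] local_fracts_add prime by blast
      then show "\<sigma> u \<in> local_fracts (Q j)" by (simp flip: assms(1))
    next
      assume "\<sigma> u \<in> local_fracts (Q j)"
      then have "\<sigma> u - w \<in> local_fracts (Q j)"
        using assms(2)[OF that] local_fracts_diff prime by blast
      then show "u \<in> local_fracts (Q j)" by (simp flip: assms(1))
    qed
    then show ?thesis using hom_in_local_fracts_iff[of u "j - 1"] by simp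
  qed
  then have "{j. u \<notin> local_fracts (Q j)} = {}"
    using finite_poles[of u] shift_invariant_eq_empty by blast
  then have "u \<in> local_fracts (Q j)" for j by auto
  \<comment> \<open>Regularity of \<open>\<sigma> u\<close> at \<open>Q 0\<close> comes from
    regularity of \<open>u\<close> at \<open>Q (- 1)\<close>.\<close>
  then have "u \<in> local_fracts (Q 0)" "\<sigma> u \<in> local_fracts (Q 0)"
    using hom_in_local_fracts_iff[of u "- 1"] by simp_all
  then show ?thesis using assms(1) local_fracts_diff prime by blast
qed

text \<open>The inverse of a nonzero fixed element is fixed, hence regular at \<open>Q 0\<close>;
  its product with \<open>t\<close> would be the non-regular element \<open>1 / Q 0\<close>.\<close>

lemma fixed_eq_0_if_prime_multiple:
  assumes "\<sigma> e = e" "e = t * to_fract (Q 0)" "t \<in> local_fracts (Q 0)"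
  shows "e = 0"
proof (rule ccontr)
  assume "e \<noteq> 0"
  then have "\<sigma> (inverse e) = inverse e"
    using hom_mult[of e "inverse e"] hom_one assms(1) by (metis inverse_unique right_inverse)
  then have "inverse e * t \<in> local_fracts (Q 0)"
    using assms(3) fixed_in_local_fracts local_fracts_mult prime by blast
  moreover have "inverse e * t = inverse (to_fract (Q 0))"
    using \<open>e \<noteq> 0\<close> assms(2) by (auto simp: field_simps)
  ultimately show False using inverse_prime_notin_local_fracts prime by metis
qed

text \<open>The right-hand side has no poles on the orbit except possibly at \<open>Q 0\<close>, so
  as a coboundary it is regular there too. Clearing denominators exhibits first
  \<open>e\<^sub>2\<close> and then \<open>e\<^sub>1\<close> as a regular multiple of
  \<open>Q 0\<close>, and a fixed element of this form is zero.\<close>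

lemma coboundary_imp_trivial:
  assumes "\<sigma> e\<^sub>1 = e\<^sub>1" "\<sigma> e\<^sub>2 = e\<^sub>2"
    and "\<sigma> u - u = e\<^sub>1 * inverse (to_fract (Q 0)) + e\<^sub>2 * (inverse (to_fract (Q 0)))\<^sup>2"
  shows "e\<^sub>1 = 0 \<and> e\<^sub>2 = 0"
proof -
  let ?q = "to_fract (Q 0)" and ?O = "local_fracts (Q 0)"
  let ?w = "e\<^sub>1 * inverse ?q + e\<^sub>2 * (inverse ?q)\<^sup>2"
  have q: "?q \<noteq> 0" "?q \<in> ?O" using prime[of 0] by (auto simp: to_fract_in_local_fracts)
  have e: "e\<^sub>1 \<in> local_fracts (Q j)" "e\<^sub>2 \<in> local_fracts (Q j)" for j
    using assms fixed_in_local_fracts by auto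
  have "?w \<in> local_fracts (Q j)" if "j \<noteq> 0" for j
    using inverse_in_local_fracts[OF Q_0_not_dvd[OF that]] e prime
    by (auto simp: power2_eq_square intro!: local_fracts_add local_fracts_mult)
  then have w: "?w \<in> ?O" using assms(3) cohomologous_to_zero_regular by blast
  have "e\<^sub>2 = (?w * ?q - e\<^sub>1) * ?q"
    using q by (simp add: field_simps power2_eq_square)
  moreover have "?w * ?q - e\<^sub>1 \<in> ?O"
    using w q e prime by (intro local_fracts_diff local_fracts_mult)
  ultimately have "e\<^sub>2 = 0" using assms(2) fixed_eq_0_if_prime_multiple by blast
  moreover from this have "e\<^sub>1 = ?w * ?q" using q by simp
  ultimately show ?thesis using assms(1) w fixed_eq_0_if_prime_multiple by blast
qed

end

section \<open>Existence of a prime with infinite orbit\<close>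

lemma automorphism_fixing_generators:
  fixes \<tau> :: "('n::{finite,linorder}, 'f::field) polynomials \<Rightarrow> ('n, 'f) polynomials"
  assumes "ring_automorphism \<tau>" "\<And>c. \<tau> (poly_const c) = poly_const c"
    and "\<And>i. \<tau> (indeterminate i) = indeterminate i"
  shows "\<tau> = id"
proof
  interpret ring_automorphism \<tau> by fact
  have power: "\<tau> (a ^ k) = \<tau> a ^ k" for a k
    by (induction k) (simp_all add: hom_one hom_mult)
  have prod: "\<tau> (prod f A) = (\<Prod>i\<in>A. \<tau> (f i))" for f and A :: "'n set"
    by (induction A rule: infinite_finite_induct) (simp_all add: hom_one hom_mult)
  show "\<tau> p = id p" for p
  proof (induction p rule: poly_mapping_induct_add)
    case (single m c)
    show ?case by (simp add: single_eq_monomial hom_mult power prod assms)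
  qed (simp_all add: hom_zero hom_add)
qed

text \<open>If \<open>X\<^sub>i\<close> and \<open>X\<^sub>i + 1\<close> are both mapped to constant multiples of themselves, then the two
  constants are equal to 1.\<close>

lemma ex_prime_not_dvd_funpow:
  fixes \<tau> :: "('n::{finite,linorder}, 'f::field) polynomials \<Rightarrow> ('n, 'f) polynomials"
  assumes "ring_automorphism \<tau>" and const: "\<And>c. \<tau> (poly_const c) = poly_const c"
    and infinite: "\<And>m. m > 0 \<Longrightarrow> \<tau> ^^ m \<noteq> id"
  shows "\<exists>p. prime_elem p \<and> (\<forall>m>0. \<not> p dvd (\<tau> ^^ m) p)"
proof (rule ccontr)
  interpret ring_automorphism \<tau> by fact
  assume "\<not> ?thesis"
  then have ex: "\<exists>m>0. p dvd (\<tau> ^^ m) p" if "prime_elem p" for p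
    using that by blast
  have const_funpow: "(\<tau> ^^ m) (poly_const c) = poly_const c" for m c
    by (induction m) (simp_all add: const)
  \<comment> \<open>The image of a prime is prime, so the cofactor is a unit and therefore
    constant.\<close>
  have "\<exists>m>0. \<exists>c. (\<tau> ^^ m) p = poly_const c * p" if p: "prime_elem p" for p
  proof -
    obtain m where m: "m > 0" "p dvd (\<tau> ^^ m) p" using ex[OF p] by blast
    interpret m: ring_automorphism "\<tau> ^^ m" by (rule ring_automorphism_funpow)
    obtain r where r: "(\<tau> ^^ m) p = p * r" using m(2) by (rule dvdE)
    have "prime_elem ((\<tau> ^^ m) p)" using p by (simp add: m.prime_elem_hom)
    then have "r dvd 1" using p r by (metis prime_elem_mult_imp_unit prime_elem_not_unit)
    then show ?thesis using m(1) r by (metis dvd_1_imp_const mult.commute)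
  qed
  then obtain m c where m: "\<And>p. prime_elem p \<Longrightarrow> m p > 0"
    and c: "\<And>p. prime_elem p \<Longrightarrow> (\<tau> ^^ m p) p = poly_const (c p) * p"
    by metis
  \<comment> \<open>The exponent \<open>m p\<close> depends on \<open>p\<close>; since its multiples
    serve as well, a common exponent can be chosen.\<close>
  have multiple: "\<exists>c'. (\<tau> ^^ (m p * k)) p = poly_const c' * p" if "prime_elem p" for p k
  proof (induction k)
    case 0
    show ?case by (rule exI[of _ 1]) (simp add: poly_const_simps)
  next
    case (Suc k)
    interpret mk: ring_automorphism "\<tau> ^^ (m p * k)" by (rule ring_automorphism_funpow)
    have "(\<tau> ^^ (m p * Suc k)) p = (\<tau> ^^ (m p * k)) (poly_const (c p) * p)"
      by (simp add: funpow_add c that add.commute[of "m p"])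
    moreover obtain c' where "(\<tau> ^^ (m p * k)) p = poly_const c' * p" using Suc by blast
    ultimately have "(\<tau> ^^ (m p * Suc k)) p = poly_const (c p * c') * p"
      by (simp add: mk.hom_mult const_funpow mult.assoc poly_const_simps(4))
    then show ?case by blast
  qed
  \<comment> \<open>The values of \<open>P\<close> are all \<open>X\<^sub>i\<close> and all
    \<open>X\<^sub>i + 1\<close>. They are indexed by a finite type, so the product \<open>M\<close>
    of their exponents works for all of them.\<close>
  define P where "P = (\<lambda>(i::'n, b). indeterminate i + poly_const (if b then 1 else 0::'f))"
  define M where "M = (\<Prod>x\<in>UNIV. m (P x))"
  have prime_P: "prime_elem (P x)" for x
    by (cases x) (auto simp: P_def intro: prime_elem_indeterminate_add_const)
  then have "M > 0" using m by (auto simp: M_def)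
  interpret M: ring_automorphism "\<tau> ^^ M" by (rule ring_automorphism_funpow)
  have M: "\<exists>c'. (\<tau> ^^ M) (P x) = poly_const c' * P x" for x
  proof -
    have "m (P x) dvd M" unfolding M_def by (rule dvd_prodI) auto
    then obtain k where "M = m (P x) * k" by (rule dvdE)
    then show ?thesis using multiple[OF prime_P, of x k] by simp
  qed
  have "(\<tau> ^^ M) (indeterminate i) = indeterminate i" for i
  proof -
    obtain c d where c: "(\<tau> ^^ M) (indeterminate i) = poly_const c * indeterminate i"
      and d: "(\<tau> ^^ M) (indeterminate i + 1) = poly_const d * (indeterminate i + 1)"
      using M[of "(i, False)"] M[of "(i, True)"] by (auto simp: P_def poly_const_simps)
    have eq: "poly_const c * indeterminate i + 1 = poly_const d * (indeterminate i + 1)"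
      using c d by (simp add: M.hom_add M.hom_one)
    have "Poly_Mapping.single i (1::nat) \<noteq> 0"
      by (metis lookup_single_eq lookup_zero zero_neq_one)
    \<comment> \<open>The constant terms give \<open>d = 1\<close>, and the coefficients of
      \<open>X\<^sub>i\<close> give \<open>c = d\<close>.\<close>
    with arg_cong[OF eq, of "\<lambda>p. Poly_Mapping.lookup p 0"]
      arg_cong[OF eq, of "\<lambda>p. Poly_Mapping.lookup p (Poly_Mapping.single i 1)"]
    have "c = d" "d = 1"
      by (auto simp: poly_const_def indeterminate_def distrib_left mult_single lookup_add
          lookup_single lookup_one when_def)
    with c show ?thesis by (simp add: poly_const_simps)
  qed
  then have "\<tau> ^^ M = id"
    using M.ring_automorphism_axioms const_funpow automorphism_fixing_generators by blast
  with infinite \<open>M > 0\<close> show False by blast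
qed

section \<open>Integer iterates and two elements independent modulo coboundaries\<close>

definition int_funpow :: "('a \<Rightarrow> 'a) \<Rightarrow> int \<Rightarrow> 'a \<Rightarrow> 'a" where
  "int_funpow f j = (if j \<ge> 0 then f ^^ nat j else inv_into UNIV f ^^ nat (- j))"

lemma int_funpow_succ:
  assumes "bij f"
  shows "f (int_funpow f j x) = int_funpow f (j + 1) x"
proof (cases "j \<ge> 0")
  case True
  then have "nat (j + 1) = Suc (nat j)" by simp
  then show ?thesis using True by (simp add: int_funpow_def)
next
  case False
  then have "nat (- j) = Suc (nat (- (j + 1)))" by simp
  then show ?thesis
    using False assms by (auto simp: int_funpow_def bij_is_surj surj_f_inv_f)
qed

lemma int_funpow_add:
  assumes "bij f"
  shows "(f ^^ k) (int_funpow f j x) = int_funpow f (j + int k) x"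
proof (induction k)
  case (Suc k)
  then show ?case
    using int_funpow_succ[OF assms, of "j + int k" x] by (simp add: add.commute add.left_commute)
qed simp

text \<open>Infinite order passes from \<open>\<sigma>\<close> to \<open>\<tau>\<close>, which
  provides a prime with infinite orbit; \<open>a\<close> and \<open>b\<close> are the inverse of
  this prime and its square.\<close>

lemma ex_independent_mod_coboundaries:
  fixes \<sigma> :: "('n::{finite,linorder}, 'f::field) rat_functions \<Rightarrow> ('n, 'f) rat_functions"
  assumes \<sigma>: "\<sigma> \<in> algebra_automorphisms rat_const" and infinite: "infinite_order \<sigma>"
    and "\<tau> \<in> algebra_automorphisms (poly_const :: 'f \<Rightarrow> ('n, 'f) polynomials)"
    and \<sigma>\<tau>: "\<And>p. \<sigma> (to_fract p) = to_fract (\<tau> p)"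
  obtains a b where
    "\<And>u e e'. \<sigma> e = e \<Longrightarrow> \<sigma> e' = e' \<Longrightarrow> \<sigma> u - u = e * a + e' * b \<Longrightarrow> e = 0 \<and> e' = 0"
proof -
  interpret \<sigma>: ring_automorphism \<sigma> using algebra_automorphismsD[OF \<sigma>] by blast
  interpret \<tau>: ring_automorphism \<tau> using algebra_automorphismsD[OF assms(3)] by blast
  \<comment> \<open>Otherwise the iterate of \<open>\<sigma>\<close> would fix all polynomials,
    hence all fractions.\<close>
  have "\<tau> ^^ m \<noteq> id" if "m > 0" for m
  proof
    assume "\<tau> ^^ m = id"
    interpret m: ring_automorphism "\<sigma> ^^ m" by (rule \<sigma>.ring_automorphism_funpow)
    have "(\<sigma> ^^ k) (to_fract p) = to_fract ((\<tau> ^^ k) p)" for k p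
      by (induction k) (simp_all add: \<sigma>\<tau>)
    then have to_fract: "(\<sigma> ^^ m) (to_fract p) = to_fract p" for p
      using \<open>\<tau> ^^ m = id\<close> by simp
    have "(\<sigma> ^^ m) x = x" for x
    proof -
      obtain a b where x: "x = to_fract a / to_fract b" "b \<noteq> 0" by (rule ex_fract)
      then have "x * to_fract b = to_fract a" by simp
      then have "(\<sigma> ^^ m) x * to_fract b = x * to_fract b"
        using m.hom_mult[of x "to_fract b"] to_fract by metis
      then show ?thesis using x(2) by simp
    qed
    then show False using infinite that by (auto simp: infinite_order_def fun_eq_iff)
  qed
  then obtain p where p: "prime_elem p" and not_dvd: "\<And>m. m > 0 \<Longrightarrow> \<not> p dvd (\<tau> ^^ m) p"
    using ex_prime_not_dvd_funpow[OF \<tau>.ring_automorphism_axioms algebra_automorphismsD(2)[OF assms(3)]]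
    by blast
  define Q where "Q j = int_funpow \<tau> j p" for j
  have shift: "(\<tau> ^^ k) (Q j) = Q (j + int k)" for j k
    unfolding Q_def by (rule int_funpow_add[OF \<tau>.bij])
  have Q_0: "Q 0 = p" by (simp add: Q_def int_funpow_def)
  have prime: "prime_elem (Q j)" for j
    unfolding Q_def int_funpow_def
    using p \<tau>.ring_automorphism_funpow
      ring_automorphism.ring_automorphism_funpow[OF \<tau>.ring_automorphism_inv]
    by (auto intro: ring_automorphism.prime_elem_hom)
  \<comment> \<open>A power of \<open>\<tau>\<close> relates the pair to \<open>Q 0\<close> and
    \<open>Q (j - i)\<close>: it is applied to the latter pair if \<open>i \<ge> 0\<close>, and to
    \<open>Q i\<close> and \<open>Q j\<close> otherwise.\<close>
  have not_dvd_less: "\<not> Q i dvd Q j" if "i < j" for i j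
  proof -
    interpret k: ring_automorphism "\<tau> ^^ k" for k by (rule \<tau>.ring_automorphism_funpow)
    have no: "\<not> Q 0 dvd Q (int k)" if "k > 0" for k
      using not_dvd[OF that] shift[of k 0] by (simp add: Q_0)
    show ?thesis
    proof (cases "i \<ge> 0")
      case True
      have "\<not> (\<tau> ^^ nat i) (Q 0) dvd (\<tau> ^^ nat i) (Q (int (nat (j - i))))"
        using no[of "nat (j - i)"] that by (simp only: k.hom_dvd_iff) simp
      then show ?thesis using True that unfolding shift by simp
    next
      case False
      have "\<not> (\<tau> ^^ nat (- i)) (Q i) dvd (\<tau> ^^ nat (- i)) (Q j)"
        using no[of "nat (j - i)"] that False by (simp add: shift)
      then show ?thesis by (simp add: k.hom_dvd_iff)
    qed
  qed
  \<comment> \<open>Divisibility among these primes is symmetric, so the case \<open>j < i\<close>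
    reduces to the one already settled.\<close>
  have not_dvd: "\<not> Q i dvd Q j" if "i \<noteq> j" for i j
  proof
    assume dvd: "Q i dvd Q j"
    then have "j < i" using not_dvd_less[of i j] that by linarith
    obtain r where r: "Q j = Q i * r" using dvd by (rule dvdE)
    have "r dvd 1" using prime r by (metis prime_elem_mult_imp_unit prime_elem_not_unit)
    then have "Q j dvd Q i" using r by simp
    then show False using not_dvd_less \<open>j < i\<close> by blast
  qed
  interpret prime_orbit \<sigma> \<tau> Q
  proof
    show "\<tau> (Q j) = Q (j + 1)" for j using shift[of 1 j] by simp
    show "finite {j. Q j dvd a}" if "a \<noteq> 0" for a
      using finite_prime_divisors[OF prime not_dvd that] .
  qed (use prime not_dvd \<sigma>\<tau> \<tau>.hom_add \<tau>.hom_mult \<tau>.hom_one \<tau>.bij in auto)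
  show thesis using that coboundary_imp_trivial by blast
qed

section \<open>Words in a skew field\<close>

lemma skew_mult_const_const: "skew_mult \<sigma> [:a:] [:b:] = [:a * b:]"
  by (simp add: skew_mult_def monom_0)

locale skew_field = ring D for D (structure) +
  fixes \<sigma> :: "'k::field \<Rightarrow> 'k" and \<phi> :: "'k poly \<Rightarrow> 'a"
  assumes \<sigma>: "ring_automorphism \<sigma>"
    and units: "Units D = carrier D - {\<zero>}"
    and \<phi>_hom: "\<phi> \<in> ring_hom (skew_poly_ring \<sigma>) D"
    and \<phi>_inj: "inj \<phi>"
begin

sublocale \<sigma>: ring_automorphism \<sigma> by (rule \<sigma>)

lemma \<phi>_closed [simp]: "\<phi> p \<in> carrier D"
  using ring_hom_memE(1)[OF \<phi>_hom] by (simp add: skew_poly_ring_def)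

lemma \<phi>_add: "\<phi> (p + q) = \<phi> p \<oplus> \<phi> q"
  using ring_hom_memE(3)[OF \<phi>_hom] by (simp add: skew_poly_ring_def)

lemma \<phi>_mult: "\<phi> (skew_mult \<sigma> p q) = \<phi> p \<otimes> \<phi> q"
  using ring_hom_memE(2)[OF \<phi>_hom] by (simp add: skew_poly_ring_def)

lemma \<phi>_one: "\<phi> 1 = \<one>"
  using ring_hom_memE(4)[OF \<phi>_hom] by (simp add: skew_poly_ring_def)

lemma \<phi>_zero: "\<phi> 0 = \<zero>"
  using \<phi>_add[of 0 0] by (metis \<phi>_closed add_0 add.l_cancel_one)

lemma \<phi>_minus: "\<phi> (- p) = \<ominus> \<phi> p"
  using \<phi>_add[of "- p" p] by (simp add: \<phi>_zero minus_equality)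

lemma \<phi>_diff: "\<phi> (p - q) = \<phi> p \<ominus> \<phi> q"
  using \<phi>_add[of p "- q"] by (simp add: \<phi>_minus minus_eq)

definition const :: "'k \<Rightarrow> 'a" where "const c = \<phi> [:c:]"

lemma const_closed [simp]: "const c \<in> carrier D"
  by (simp add: const_def)

lemma const_mult: "const (a * b) = const a \<otimes> const b"
  by (simp add: const_def skew_mult_const_const flip: \<phi>_mult)

lemma const_add: "const (a + b) = const a \<oplus> const b"
  by (simp add: const_def flip: \<phi>_add)

lemma const_zero: "const 0 = \<zero>"
  by (simp add: const_def \<phi>_zero)

lemma const_one: "const 1 = \<one>"
  by (simp add: const_def \<phi>_one flip: one_pCons)

lemma const_minus: "const (- a) = \<ominus> const a"
  using \<phi>_minus[of "[:a:]"] by (simp add: const_def)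

section \<open>The indeterminate and the inverse of one minus it\<close>

definition \<xi> :: 'a where "\<xi> = \<phi> (Polynomial.monom 1 1)"

definition \<eta> :: 'a where "\<eta> = inv (\<one> \<ominus> \<xi>)"

lemma xi_closed [simp]: "\<xi> \<in> carrier D"
  by (simp add: \<xi>_def)

lemma xi_const: "\<xi> \<otimes> const c = const (\<sigma> c) \<otimes> \<xi>"
  using skew_mult_X_const[of \<sigma> c, OF \<sigma>.hom_zero]
  by (simp add: \<xi>_def const_def flip: \<phi>_mult)

lemma one_minus_xi: "\<one> \<ominus> \<xi> = \<phi> [:1, - 1:]"
  by (simp add: \<xi>_def one_pCons monom_Suc flip: \<phi>_one \<phi>_diff)

lemma one_minus_xi_unit: "\<one> \<ominus> \<xi> \<in> Units D"
proof -
  have "\<phi> [:1, - 1:] \<noteq> \<phi> 0" using \<phi>_inj by (simp add: inj_eq)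
  then show ?thesis by (simp add: units one_minus_xi \<phi>_zero)
qed

lemma eta_closed [simp]: "\<eta> \<in> carrier D"
  by (simp add: \<eta>_def one_minus_xi_unit)

lemma eta_inverse: "(\<one> \<ominus> \<xi>) \<otimes> \<eta> = \<one>" "\<eta> \<otimes> (\<one> \<ominus> \<xi>) = \<one>"
  by (simp_all add: \<eta>_def one_minus_xi_unit)

lemma xi_eta: "\<xi> \<otimes> \<eta> = \<eta> \<ominus> \<one>"
proof -
  have "\<eta> \<ominus> \<xi> \<otimes> \<eta> = \<one>"
    using eta_inverse(1) by (simp add: minus_eq l_distr l_minus)
  then have "\<eta> \<ominus> \<one> = \<eta> \<ominus> (\<eta> \<ominus> \<xi> \<otimes> \<eta>)" by simp
  also have "\<dots> = \<xi> \<otimes> \<eta>"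
    by (simp add: minus_eq minus_add a_assoc[symmetric] r_neg)
  finally show ?thesis by simp
qed

text \<open>A fixed \<open>c\<close> commutes with \<open>\<xi>\<close>, hence with
  \<open>1 - \<xi>\<close>; multiplying by \<open>\<eta>\<close> on both sides carries this over to
  the inverse.\<close>

lemma eta_const_commute:
  assumes "\<sigma> c = c"
  shows "\<eta> \<otimes> const c = const c \<otimes> \<eta>"
proof -
  have "(\<one> \<ominus> \<xi>) \<otimes> const c = const c \<otimes> (\<one> \<ominus> \<xi>)"
    using xi_const[of c] assms by (simp add: minus_eq l_distr r_distr l_minus r_minus)
  then have "\<eta> \<otimes> ((\<one> \<ominus> \<xi>) \<otimes> const c) \<otimes> \<eta> = \<eta> \<otimes> (const c \<otimes> (\<one> \<ominus> \<xi>)) \<otimes> \<eta>" by simp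
  moreover have "\<eta> \<otimes> ((\<one> \<ominus> \<xi>) \<otimes> const c) \<otimes> \<eta> = const c \<otimes> \<eta>"
    using eta_inverse(2) by (simp flip: m_assoc)
  moreover have "\<eta> \<otimes> (const c \<otimes> (\<one> \<ominus> \<xi>)) \<otimes> \<eta> = \<eta> \<otimes> const c"
    using eta_inverse(1) by (simp add: m_assoc)
  ultimately show ?thesis by simp
qed

text \<open>\<open>\<sigma>\<close> fixes \<open>1\<close> and \<open>- 1\<close>, so nothing is
  twisted and the product is the commutative one.\<close>

lemma skew_mult_one_minus_xi: "skew_mult \<sigma> p [:1, - 1:] = p * [:1, - 1:]"
proof -
  have pow: "(\<sigma> ^^ i) 1 = 1" "(\<sigma> ^^ i) (- 1) = - 1" for i
    by (induction i) (simp_all add: \<sigma>.hom_one \<sigma>.hom_minus)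
  have "skew_mult \<sigma> p [:1, - 1:] =
    (\<Sum>i\<le>degree p. Polynomial.monom (poly.coeff p i) i * [:1, - 1:])"
    unfolding skew_mult_def
    by (intro sum.cong) (simp_all add: pow monom_Suc minus_monom)
  then show ?thesis
    by (simp only: sum_distrib_right[symmetric] poly_as_sum_of_monoms)
qed

text \<open>Multiplication by \<open>1 - \<xi>\<close> on the right gives
  \<open>c = p (1 - X)\<close> for ordinary polynomials, and the degree forces
  \<open>p = 0\<close>.\<close>

lemma const_eta_in_range:
  assumes "const c \<otimes> \<eta> = \<phi> p"
  shows "c = 0"
proof -
  have "const c = const c \<otimes> (\<eta> \<otimes> (\<one> \<ominus> \<xi>))" by (simp add: eta_inverse)
  also have "\<dots> = \<phi> p \<otimes> (\<one> \<ominus> \<xi>)" using assms by (simp flip: m_assoc)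
  also have "\<dots> = \<phi> (p * [:1, - 1:])"
    by (simp only: one_minus_xi skew_mult_one_minus_xi flip: \<phi>_mult)
  finally have "[:c:] = p * [:1, - 1:]" using \<phi>_inj by (simp add: const_def inj_eq)
  then have "degree (p * [:1, - 1:]) = 0" by (metis degree_pCons_0)
  then have "p = 0" by (cases "p = 0") (simp_all add: degree_mult_eq del: mult_pCons_right)
  then show ?thesis using \<open>[:c:] = _\<close> by simp
qed

end

text \<open>\<open>independent\<close> expresses that the classes of the \<open>\<alpha> s\<close>
  modulo the image of \<open>\<sigma> - 1\<close> are linearly independent over the fixed field of
  \<open>\<sigma>\<close>.\<close>

locale skew_words = skew_field D \<sigma> \<phi> for D (structure) and \<sigma> :: "'k::field \<Rightarrow> 'k" and \<phi> +
  fixes \<alpha> :: "'x \<Rightarrow> 'k" and S :: "'x set"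
  assumes finite_S: "finite S"
    and independent:
      "\<lbrakk>\<And>s. s \<in> S \<Longrightarrow> \<sigma> (e s) = e s; \<sigma> u - u = (\<Sum>s\<in>S. e s * \<alpha> s); s \<in> S\<rbrakk> \<Longrightarrow> e s = 0"
begin

text \<open>A word has one more factor \<open>\<eta>\<close> than letters. The leading factor lets
  \<open>\<xi>\<close> act through \<open>xi_eta\<close>, and even the empty word lies outside the
  skew polynomials.\<close>

fun word :: "'x list \<Rightarrow> 'a" where
  "word [] = \<eta>"
| "word (s # w) = \<eta> \<otimes> const (\<alpha> s) \<otimes> word w"

lemma word_closed [simp]: "word w \<in> carrier D"
  by (induction w) simp_all

text \<open>The leading \<open>\<eta>\<close> absorbs \<open>\<xi>\<close> and leaves behind a
  constant times the word without its first letter.\<close>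

lemma xi_word_Cons: "\<xi> \<otimes> word (s # w) = word (s # w) \<ominus> const (\<alpha> s) \<otimes> word w"
proof -
  have "\<xi> \<otimes> word (s # w) = \<xi> \<otimes> \<eta> \<otimes> (const (\<alpha> s) \<otimes> word w)" by (simp add: m_assoc)
  also have "\<dots> = word (s # w) \<ominus> const (\<alpha> s) \<otimes> word w"
    by (simp add: xi_eta minus_eq l_distr l_minus m_assoc)
  finally show ?thesis .
qed

text \<open>\<open>combination f d\<close> states that \<open>d\<close> is congruent to \<open>\<Sum>\<^sub>w f(w) word(w)\<close> modulo the skew
  polynomials.\<close>

inductive combination :: "('x list \<Rightarrow> 'k) \<Rightarrow> 'a \<Rightarrow> bool" where
  zero: "combination (\<lambda>_. 0) (\<phi> p)"
| add: "combination f d \<Longrightarrow> w \<in> lists S \<Longrightarrow>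
    combination (f(w := f w + c)) (d \<oplus> const c \<otimes> word w)"

lemma combination_closed: "combination f d \<Longrightarrow> d \<in> carrier D"
  by (induction rule: combination.induct) simp_all

lemma combination_support: "combination f d \<Longrightarrow> f w \<noteq> 0 \<Longrightarrow> w \<in> lists S"
  by (induction arbitrary: w rule: combination.induct) (auto split: if_splits)

lemma finite_combination_support: "combination f d \<Longrightarrow> finite {w. f w \<noteq> 0}"
proof (induction rule: combination.induct)
  case (add f d w c)
  have "{v. (f(w := f w + c)) v \<noteq> 0} \<subseteq> insert w {v. f v \<noteq> 0}" by auto
  then show ?case using add.IH finite_subset by blast
qed simp

lemma combination_scale:
  "combination f d \<Longrightarrow> combination (\<lambda>w. k * f w) (const k \<otimes> d)"
proof (induction rule: combination.induct)
  case (zero p)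
  show ?case
    using combination.zero[of "skew_mult \<sigma> [:k:] p"] by (simp add: \<phi>_mult const_def)
next
  case (add f d w c)
  have "(\<lambda>v. k * f v)(w := k * f w + k * c) = (\<lambda>v. k * (f(w := f w + c)) v)"
    by (auto simp: fun_eq_iff distrib_left)
  moreover have "const k \<otimes> (d \<oplus> const c \<otimes> word w) = const k \<otimes> d \<oplus> const (k * c) \<otimes> word w"
    using combination_closed[OF add.hyps(1)] by (simp add: r_distr const_mult m_assoc)
  ultimately show ?case
    using combination.add[OF add.IH add.hyps(2), of "k * c"] by simp
qed

lemma combination_add_range: "combination f d \<Longrightarrow> combination f (d \<oplus> \<phi> q)"
proof (induction rule: combination.induct)
  case (zero p)
  show ?case using combination.zero[of "p + q"] by (simp add: \<phi>_add)
next
  case (add f d w c)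
  have "d \<oplus> const c \<otimes> word w \<oplus> \<phi> q = d \<oplus> \<phi> q \<oplus> const c \<otimes> word w"
    using combination_closed[OF add.hyps(1)] by (simp add: a_ac)
  then show ?case using combination.add[OF add.IH add.hyps(2), of c] by (simp only:)
qed

text \<open>These are the coefficients of \<open>\<xi> \<otimes> d \<ominus> d\<close>: moving
  \<open>\<xi>\<close> past a coefficient applies \<open>\<sigma>\<close>, and the sum collects the
  multiples of \<open>word w\<close> split off from the words \<open>s # w\<close>.\<close>

definition shift :: "('x list \<Rightarrow> 'k) \<Rightarrow> 'x list \<Rightarrow> 'k" where
  "shift f w = \<sigma> (f w) - f w - (\<Sum>s\<in>S. \<sigma> (f (s # w)) * \<alpha> s)"

lemma combination_shift:
  "combination f d \<Longrightarrow> combination (shift f) (\<xi> \<otimes> d \<ominus> d)"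
proof (induction rule: combination.induct)
  case (zero p)
  have "\<xi> \<otimes> \<phi> p \<ominus> \<phi> p = \<phi> (skew_mult \<sigma> (Polynomial.monom 1 1) p - p)"
    by (simp add: \<phi>_diff \<phi>_mult \<xi>_def)
  moreover have "shift (\<lambda>_. 0) = (\<lambda>_. 0)" by (simp add: shift_def fun_eq_iff \<sigma>.hom_zero)
  ultimately show ?case using combination.zero by simp
next
  case (add f d w c)
  let ?f = "f(w := f w + c)" and ?d = "\<xi> \<otimes> d \<ominus> d"
  have d: "d \<in> carrier D" using add.hyps(1) by (rule combination_closed)
  have "\<xi> \<otimes> (d \<oplus> const c \<otimes> word w) \<ominus> (d \<oplus> const c \<otimes> word w) =
      ?d \<oplus> (\<xi> \<otimes> const c \<otimes> word w \<ominus> const c \<otimes> word w)"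
    using d by (simp add: minus_eq r_distr minus_add a_ac m_assoc)
  also have "\<xi> \<otimes> const c \<otimes> word w = const (\<sigma> c) \<otimes> (\<xi> \<otimes> word w)"
    by (simp add: xi_const m_assoc)
  finally have eq: "\<xi> \<otimes> (d \<oplus> const c \<otimes> word w) \<ominus> (d \<oplus> const c \<otimes> word w) =
      ?d \<oplus> (const (\<sigma> c) \<otimes> (\<xi> \<otimes> word w) \<ominus> const c \<otimes> word w)" .
  have step: "combination ((shift f)(w := shift f w + (\<sigma> c - c))) (?d \<oplus> const (\<sigma> c - c) \<otimes> word w)"
    using add.IH add.hyps(2) by (rule combination.add)
  have diff: "const (\<sigma> c - c) = const (\<sigma> c) \<ominus> const c"
    using const_add[of "\<sigma> c" "- c"] by (simp add: const_minus minus_eq)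
  show ?case
  proof (cases w)
    case Nil
    \<comment> \<open>Here \<open>\<xi> \<eta> = \<eta> - 1\<close> leaves the constant
      \<open>- \<sigma> c\<close>, a skew polynomial, so no further coefficient changes.\<close>
    have "?d \<oplus> const (\<sigma> c - c) \<otimes> word w \<oplus> \<phi> [:- \<sigma> c:] =
      ?d \<oplus> (const (\<sigma> c) \<otimes> (\<xi> \<otimes> word w) \<ominus> const c \<otimes> word w)"
      unfolding const_def[symmetric]
      using d by (simp add: Nil xi_eta diff const_minus minus_eq l_distr r_distr l_minus r_minus a_ac)
    moreover have "shift ?f = (shift f)(w := shift f w + (\<sigma> c - c))"
      by (auto simp: Nil shift_def fun_eq_iff \<sigma>.hom_add)
    ultimately show ?thesis
      using combination_add_range[OF step, of "[:- \<sigma> c:]"] eq by metis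
  next
    case (Cons s v)
    have s: "s \<in> S" "v \<in> lists S" "v \<noteq> w" "w \<noteq> v" using add.hyps(2) Cons by auto
    let ?g = "(shift f)(w := shift f w + (\<sigma> c - c))"
    have "?d \<oplus> const (\<sigma> c - c) \<otimes> word w \<oplus> const (- (\<sigma> c * \<alpha> s)) \<otimes> word v =
      ?d \<oplus> (const (\<sigma> c) \<otimes> (\<xi> \<otimes> word w) \<ominus> const c \<otimes> word w)"
      using d unfolding Cons xi_word_Cons
      by (simp add: diff const_minus const_mult minus_eq l_distr r_distr l_minus r_minus a_ac m_assoc
          del: word.simps)
    moreover have "shift ?f = ?g(v := ?g v + - (\<sigma> c * \<alpha> s))"
    proof
      fix u
      have "\<sigma> (?f (t # u)) * \<alpha> t = \<sigma> (f (t # u)) * \<alpha> t +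
          (if t = s then (if u = v then \<sigma> c * \<alpha> s else 0) else 0)" for t
        by (auto simp: Cons \<sigma>.hom_add distrib_right)
      then have "(\<Sum>t\<in>S. \<sigma> (?f (t # u)) * \<alpha> t) =
          (\<Sum>t\<in>S. \<sigma> (f (t # u)) * \<alpha> t) + (if u = v then \<sigma> c * \<alpha> s else 0)"
        using s finite_S by (simp add: sum.distrib)
      then show "shift ?f u = (?g(v := ?g v + - (\<sigma> c * \<alpha> s))) u"
        using s by (simp add: shift_def \<sigma>.hom_add)
    qed
    ultimately show ?thesis
      using combination.add[OF step s(2), of "- (\<sigma> c * \<alpha> s)"] eq by metis
  qed
qed

text \<open>The inductive relation becomes an explicit sum. \<open>A\<close> may exceed the support,
  since coefficients can cancel during the construction.\<close>

lemma combination_finsum: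
  assumes "combination f d"
  obtains A p where "finite A" "{w. f w \<noteq> 0} \<subseteq> A" "d = \<phi> p \<oplus> (\<Oplus>w\<in>A. const (f w) \<otimes> word w)"
  using assms
proof (induction arbitrary: thesis rule: combination.induct)
  case (zero p)
  show ?case by (rule zero[of "{}" p]) simp_all
next
  case (add f d w c)
  obtain A p where A: "finite A" "{w. f w \<noteq> 0} \<subseteq> A" "d = \<phi> p \<oplus> (\<Oplus>w\<in>A. const (f w) \<otimes> word w)"
    by (rule add.IH)
  let ?f = "f(w := f w + c)"
  \<comment> \<open>The term of \<open>w\<close> is kept apart so that its coefficient can grow by
    \<open>c\<close>, whether or not \<open>w\<close> belongs to \<open>A\<close>.\<close>
  let ?r = "\<Oplus>v\<in>A - {w}. const (f v) \<otimes> word v"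
  have "(\<Oplus>v\<in>A. const (f v) \<otimes> word v) = const (f w) \<otimes> word w \<oplus> ?r"
  proof (cases "w \<in> A")
    case True
    have "(\<Oplus>v\<in>insert w (A - {w}). const (f v) \<otimes> word v) = const (f w) \<otimes> word w \<oplus> ?r"
      using A(1) by (intro finsum_insert) auto
    then show ?thesis by (simp only: insert_Diff[OF True])
  next
    case False
    then have "f w = 0" "A - {w} = A" using A(2) by auto
    then show ?thesis by (simp add: const_zero)
  qed
  moreover have "(\<Oplus>v\<in>insert w (A - {w}). const (?f v) \<otimes> word v) = const (f w + c) \<otimes> word w \<oplus> ?r"
  proof -
    have "(\<Oplus>v\<in>A - {w}. const (?f v) \<otimes> word v) = ?r"
      by (rule finsum_cong') auto
    then show ?thesis using A(1) by (subst finsum_insert) auto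
  qed
  ultimately have "d \<oplus> const c \<otimes> word w =
      \<phi> p \<oplus> (\<Oplus>v\<in>insert w (A - {w}). const (?f v) \<otimes> word v)"
    by (simp add: A(3) const_add l_distr a_ac)
  then show ?case using A by (intro add.prems[of "insert w (A - {w})" p]) auto
qed

text \<open>Only the empty word can contribute, so \<open>f []\<close> times \<open>\<eta>\<close>
  is a difference of skew polynomials.\<close>

lemma combination_Nil:
  assumes "combination f (\<phi> q)" and "\<And>w. w \<noteq> [] \<Longrightarrow> f w = 0"
  shows "f [] = 0"
proof -
  obtain A p where A: "finite A" "{w. f w \<noteq> 0} \<subseteq> A"
    and q: "\<phi> q = \<phi> p \<oplus> (\<Oplus>w\<in>A. const (f w) \<otimes> word w)"
    using assms(1) by (rule combination_finsum)
  have "(\<Oplus>w\<in>A. const (f w) \<otimes> word w) = const (f []) \<otimes> \<eta>"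
  proof (cases "[] \<in> A")
    case True
    have "(\<Oplus>w\<in>A. const (f w) \<otimes> word w) = (\<Oplus>w\<in>A. if [] = w then const (f []) \<otimes> \<eta> else \<zero>)"
      by (rule finsum_cong') (auto simp: assms(2) const_zero)
    then show ?thesis using True A(1) by (simp add: add.finprod_singleton)
  next
    case False
    then have "f w = 0" for w using A(2) assms(2) by (cases w) auto
    then show ?thesis by (simp add: const_zero)
  qed
  then have "\<phi> q = const (f []) \<otimes> \<eta> \<oplus> \<phi> p"
    using q by (simp add: a_comm)
  then have "const (f []) \<otimes> \<eta> = \<phi> q \<ominus> \<phi> p"
    by (simp add: minus_eq a_assoc r_neg)
  then show ?thesis using const_eta_in_range by (simp flip: \<phi>_diff)
qed

text \<open>A relation with top coefficients normalized at one word is shifted to a relation with fewer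
  top coefficients, hence to zero. This says that the top coefficients are fixed by \<open>\<sigma>\<close>, and
  comparing the coefficients of the words that are shorter by one letter contradicts the
  independence of the \<open>\<alpha> s\<close> modulo the image of \<open>\<sigma> - 1\<close>.\<close>

lemma combination_eq_zero_aux:
  assumes "combination f (\<phi> p)" and "\<And>w. f w \<noteq> 0 \<Longrightarrow> length w < n"
  shows "f w = 0"
  using assms
proof (induction n arbitrary: f p w)
  case (Suc n)
  then show ?case
  \<comment> \<open>The inner induction is on the number of words of the top length \<open>n\<close>
    with nonzero coefficient.\<close>
  proof (induction "card {w. f w \<noteq> 0 \<and> length w = n}" arbitrary: f p w rule: less_induct)
    case less
    show ?case
    proof (cases "\<exists>w. f w \<noteq> 0 \<and> length w = n")
      case False
      then have "length w < n" if "f w \<noteq> 0" for w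
        using less.prems(3)[OF that] that less_antisym by blast
      then show ?thesis using less.prems(1,2) by blast
    next
      case True
      then obtain w0 where w0: "f w0 \<noteq> 0" "length w0 = n" by blast
      show ?thesis
      proof (cases w0)
        case Nil
        then have "f w = 0" if "w \<noteq> []" for w using less.prems(3)[of w] w0 that by force
        then show ?thesis using combination_Nil less.prems(2) w0 Nil by blast
      next
        case (Cons s v)
        \<comment> \<open>Once \<open>g w0 = 1\<close>, the difference
          \<open>\<sigma> (g w0) - g w0\<close> vanishes, so \<open>w0\<close> is no longer among
          the top words of \<open>shift g\<close>.\<close>
        define g where "g w = inverse (f w0) * f w" for w
        have g_iff: "g w \<noteq> 0 \<longleftrightarrow> f w \<noteq> 0" for w using w0 by (simp add: g_def)
        have "combination g (\<phi> (skew_mult \<sigma> [:inverse (f w0):] p))"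
          using combination_scale[OF less.prems(2), of "inverse (f w0)"]
          by (simp add: g_def[abs_def] \<phi>_mult const_def)
        then obtain q where q: "combination g (\<phi> q)" by blast
        have long: "g w = 0" if "length w > n" for w
          using less.prems(3)[of w] that g_iff[of w] by force
        \<comment> \<open>Prefixing a letter leads beyond length \<open>n\<close>, where
          \<open>g\<close> is zero, so the sum in \<open>shift\<close> disappears.\<close>
        then have shift_top: "shift g w = \<sigma> (g w) - g w" if "length w \<ge> n" for w
          using that by (simp add: shift_def \<sigma>.hom_zero less_Suc_eq_le)
        have "g w0 = 1" using w0 by (simp add: g_def)
        have zero: "shift g w = 0" for w
        proof (rule less.hyps)
          have "{w. shift g w \<noteq> 0 \<and> length w = n} \<subseteq> {w. f w \<noteq> 0 \<and> length w = n} - {w0}"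
          proof
            fix w assume "w \<in> {w. shift g w \<noteq> 0 \<and> length w = n}"
            then have "\<sigma> (g w) - g w \<noteq> 0" "length w = n" using shift_top[of w] by simp_all
            then have "g w \<noteq> 0" "w \<noteq> w0"
              using \<open>g w0 = 1\<close> by (auto simp: \<sigma>.hom_zero \<sigma>.hom_one)
            with \<open>length w = n\<close> show "w \<in> {w. f w \<noteq> 0 \<and> length w = n} - {w0}"
              using g_iff by simp
          qed
          moreover have "finite {w. f w \<noteq> 0 \<and> length w = n}"
            by (rule finite_subset[OF _ finite_combination_support[OF less.prems(2)]]) auto
          ultimately show "card {w. shift g w \<noteq> 0 \<and> length w = n} < card {w. f w \<noteq> 0 \<and> length w = n}"
            using w0 by (intro psubset_card_mono) auto
          have "\<xi> \<otimes> \<phi> q \<ominus> \<phi> q = \<phi> (skew_mult \<sigma> (Polynomial.monom 1 1) q - q)"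
            by (simp add: \<phi>_diff \<phi>_mult \<xi>_def)
          then show "combination (shift g) (\<phi> (skew_mult \<sigma> (Polynomial.monom 1 1) q - q))"
            using combination_shift[OF q] by simp
          show "length w < Suc n" if "shift g w \<noteq> 0" for w
          proof (rule ccontr)
            assume "\<not> length w < Suc n"
            then have "shift g w = 0" using shift_top[of w] long[of w] by (simp add: \<sigma>.hom_zero)
            with that show False by simp
          qed
        qed (use less.prems(1) in blast)
        have fixed: "\<sigma> (g w) = g w" if "length w = n" for w
          using shift_top[of w] zero[of w] that by simp
        have "length (t # v) = n" for t using w0 Cons by simp
        \<comment> \<open>The vanishing of \<open>shift g\<close> at \<open>v\<close>, one letter
          shorter than \<open>w0\<close>, writes a coboundary as a combination of the
          \<open>\<alpha> t\<close> with fixed coefficients. Independence makes these zero, although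
          one of them is \<open>g w0 = 1\<close>.\<close>
        then have "\<sigma> (g v) - g v = (\<Sum>t\<in>S. g (t # v) * \<alpha> t)"
          using zero[of v] fixed by (simp add: shift_def)
        moreover have "s \<in> S" using combination_support[OF less.prems(2) w0(1)] Cons by simp
        moreover have "\<sigma> (g (t # v)) = g (t # v)" for t using fixed w0 Cons by simp
        ultimately have "g (s # v) = 0"
          by (intro independent[of "\<lambda>t. g (t # v)" "g v" s])
        with \<open>g w0 = 1\<close> Cons show ?thesis by simp
      qed
    qed
  qed
qed auto

lemma combination_eq_zero:
  assumes "combination f (\<phi> p)"
  shows "f w = 0"
proof (rule combination_eq_zero_aux[OF assms])
  let ?L = "length ` {w. f w \<noteq> 0}"
  have "finite ?L" using finite_combination_support[OF assms] by simp
  then show "length w < Suc (Max ?L)" if "f w \<noteq> 0" for w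
    using that by (simp add: less_Suc_eq_le)
qed

end

section \<open>The free subalgebra\<close>

locale skew_free = skew_words D \<sigma> \<phi> \<alpha> S + \<kappa>: coefficient_hom \<kappa>
  for D (structure) and \<sigma> :: "'k::field \<Rightarrow> 'k" and \<phi> and \<alpha> :: "'x \<Rightarrow> 'k" and S
    and \<kappa> :: "'f::field \<Rightarrow> 'k" +
  assumes \<sigma>_\<kappa>: "\<sigma> (\<kappa> c) = \<kappa> c"
begin

text \<open>The free generators are \<open>const (\<alpha> s) \<otimes> \<eta>\<close>; their
  products lack the leading \<open>\<eta>\<close> of a word.\<close>

fun monomial :: "'x list \<Rightarrow> 'a" where
  "monomial [] = \<one>"
| "monomial (s # w) = const (\<alpha> s) \<otimes> \<eta> \<otimes> monomial w"

lemma monomial_closed [simp]: "monomial w \<in> carrier D"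
  by (induction w) simp_all

lemma monomial_append: "monomial (u @ v) = monomial u \<otimes> monomial v"
  by (induction u) (simp_all add: m_assoc)

lemma eta_monomial: "\<eta> \<otimes> monomial w = word w"
  by (induction w) (simp_all add: m_assoc)

lemma scalar_eta: "\<eta> \<otimes> const (\<kappa> c) = const (\<kappa> c) \<otimes> \<eta>"
  by (rule eta_const_commute[OF \<sigma>_\<kappa>])

lemma const_commute: "const a \<otimes> const b = const b \<otimes> const a"
  by (simp add: mult.commute flip: const_mult)

text \<open>Scalars commute with the \<open>\<alpha> s\<close> because the coefficient field is
  commutative, and with \<open>\<eta>\<close> because \<open>\<sigma>\<close> fixes them.\<close>

lemma scalar_monomial: "monomial w \<otimes> const (\<kappa> c) = const (\<kappa> c) \<otimes> monomial w"
proof (induction w)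
  case (Cons s w)
  have "monomial (s # w) \<otimes> const (\<kappa> c) = const (\<alpha> s) \<otimes> (\<eta> \<otimes> (monomial w \<otimes> const (\<kappa> c)))"
    by (simp add: m_assoc)
  also have "\<dots> = const (\<alpha> s) \<otimes> (\<eta> \<otimes> const (\<kappa> c)) \<otimes> monomial w"
    by (simp add: Cons.IH m_assoc)
  also have "\<dots> = const (\<alpha> s) \<otimes> const (\<kappa> c) \<otimes> \<eta> \<otimes> monomial w"
    by (simp add: scalar_eta m_assoc)
  also have "\<dots> = const (\<kappa> c) \<otimes> monomial (s # w)"
    by (subst const_commute) (simp add: m_assoc)
  finally show ?case .
qed simp

section \<open>Evaluation of the free algebra\<close>

definition eval_free :: "('x list \<Rightarrow>\<^sub>0 'f) \<Rightarrow> 'a" where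
  "eval_free p = (\<Oplus>w\<in>Poly_Mapping.keys p. const (\<kappa> (Poly_Mapping.lookup p w)) \<otimes> monomial w)"

lemma eval_free_closed [simp]: "eval_free p \<in> carrier D"
  by (auto simp: eval_free_def intro: finsum_closed)

lemma eval_free_superset:
  assumes "finite A" "Poly_Mapping.keys p \<subseteq> A"
  shows "eval_free p = (\<Oplus>w\<in>A. const (\<kappa> (Poly_Mapping.lookup p w)) \<otimes> monomial w)"
  unfolding eval_free_def
  by (rule add.finprod_mono_neutral_cong_left)
    (use assms in \<open>auto simp: in_keys_iff \<kappa>.C_zero const_zero\<close>)

lemma eval_free_zero: "eval_free 0 = \<zero>"
  by (simp add: eval_free_def)

lemma eval_free_add: "eval_free (p + q) = eval_free p \<oplus> eval_free q"
proof -
  let ?A = "Poly_Mapping.keys p \<union> Poly_Mapping.keys q"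
  let ?t = "\<lambda>p w. const (\<kappa> (Poly_Mapping.lookup p w)) \<otimes> monomial w"
  have "Poly_Mapping.keys (p + q) \<subseteq> ?A"
    by (rule Poly_Mapping.keys_add)
  then have "eval_free (p + q) = (\<Oplus>w\<in>?A. ?t p w \<oplus> ?t q w)"
    by (subst eval_free_superset[of ?A]) (simp_all add: lookup_add \<kappa>.C_add const_add l_distr)
  also have "\<dots> = (\<Oplus>w\<in>?A. ?t p w) \<oplus> (\<Oplus>w\<in>?A. ?t q w)"
    by (rule finsum_addf) auto
  also have "\<dots> = eval_free p \<oplus> eval_free q"
    by (simp add: eval_free_superset[of ?A])
  finally show ?thesis .
qed

lemma eval_free_single: "eval_free (Poly_Mapping.single w c) = const (\<kappa> c) \<otimes> monomial w"
proof -
  have "eval_free (Poly_Mapping.single w c) =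
      (\<Oplus>v\<in>{w}. const (\<kappa> (Poly_Mapping.lookup (Poly_Mapping.single w c) v)) \<otimes> monomial v)"
    by (rule eval_free_superset) simp_all
  then show ?thesis by (simp add: finsum_insert)
qed

lemma eval_free_sum: "finite I \<Longrightarrow> eval_free (\<Sum>i\<in>I. f i) = (\<Oplus>i\<in>I. eval_free (f i))"
  by (induction I rule: finite_induct) (simp_all add: eval_free_zero eval_free_add)

lemma eval_free_mult: "eval_free (free_mult p q) = eval_free p \<otimes> eval_free q"
proof -
  let ?t = "\<lambda>p w. const (\<kappa> (Poly_Mapping.lookup p w)) \<otimes> monomial w"
  have product: "eval_free (Poly_Mapping.single (u @ v)
        (Poly_Mapping.lookup p u * Poly_Mapping.lookup q v)) = ?t p u \<otimes> ?t q v" for u v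
  proof -
    let ?a = "const (\<kappa> (Poly_Mapping.lookup p u))" and ?b = "const (\<kappa> (Poly_Mapping.lookup q v))"
    have "?t p u \<otimes> ?t q v = ?a \<otimes> (monomial u \<otimes> ?b) \<otimes> monomial v"
      by (simp add: m_assoc)
    also have "\<dots> = ?a \<otimes> ?b \<otimes> (monomial u \<otimes> monomial v)"
      by (simp add: scalar_monomial m_assoc)
    finally show ?thesis
      by (simp add: eval_free_single monomial_append \<kappa>.C_mult const_mult)
  qed
  have "eval_free (free_mult p q) =
      (\<Oplus>u\<in>Poly_Mapping.keys p. \<Oplus>v\<in>Poly_Mapping.keys q. ?t p u \<otimes> ?t q v)"
    by (simp add: free_mult_def eval_free_sum product)
  also have "\<dots> = (\<Oplus>u\<in>Poly_Mapping.keys p. ?t p u \<otimes> eval_free q)"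
    by (rule finsum_cong') (auto simp: eval_free_def intro!: finsum_rdistr[symmetric])
  also have "\<dots> = eval_free p \<otimes> eval_free q"
    unfolding eval_free_def[of p] by (rule finsum_ldistr[symmetric]) auto
  finally show ?thesis .
qed

text \<open>Left multiplication by \<open>\<eta>\<close> turns monomials into words, and
  \<open>\<eta>\<close> passes the scalar coefficients unchanged.\<close>

lemma combination_eval_free:
  assumes "Poly_Mapping.keys p \<subseteq> lists S"
  shows "combination (\<lambda>w. \<kappa> (Poly_Mapping.lookup p w)) (\<eta> \<otimes> eval_free p)"
proof -
  let ?t = "\<lambda>w. const (\<kappa> (Poly_Mapping.lookup p w)) \<otimes> monomial w"
  have "combination (\<lambda>w. if w \<in> A then \<kappa> (Poly_Mapping.lookup p w) else 0)
      (\<eta> \<otimes> (\<Oplus>w\<in>A. ?t w))"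
    if "finite A" "A \<subseteq> lists S" for A
    using that
  proof (induction A)
    case empty
    then show ?case using combination.zero[of 0] by (simp add: \<phi>_zero)
  next
    case (insert w A)
    let ?f = "\<lambda>w. if w \<in> A then \<kappa> (Poly_Mapping.lookup p w) else 0"
    let ?c = "\<kappa> (Poly_Mapping.lookup p w)"
    have "\<eta> \<otimes> ?t w = \<eta> \<otimes> const ?c \<otimes> monomial w" by (simp add: m_assoc)
    also have "\<dots> = const ?c \<otimes> word w" by (simp add: scalar_eta m_assoc eta_monomial)
    finally have "\<eta> \<otimes> ?t w = const ?c \<otimes> word w" .
    then have sum: "\<eta> \<otimes> (\<Oplus>w\<in>insert w A. ?t w) = \<eta> \<otimes> (\<Oplus>w\<in>A. ?t w) \<oplus> const ?c \<otimes> word w"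
      using insert.hyps by (simp add: finsum_insert r_distr a_comm)
    have coeffs: "(\<lambda>v. if v \<in> insert w A then \<kappa> (Poly_Mapping.lookup p v) else 0) =
        ?f(w := ?f w + ?c)"
      using insert.hyps by (auto simp: fun_eq_iff)
    have "combination ?f (\<eta> \<otimes> (\<Oplus>w\<in>A. ?t w))" "w \<in> lists S"
      using insert by auto
    then show ?case unfolding sum coeffs by (rule combination.add)
  qed
  from this[of "Poly_Mapping.keys p"]
  have "combination (\<lambda>w. if w \<in> Poly_Mapping.keys p then \<kappa> (Poly_Mapping.lookup p w) else 0)
      (\<eta> \<otimes> eval_free p)"
    using assms by (simp add: eval_free_def)
  moreover have "(\<lambda>w. if w \<in> Poly_Mapping.keys p then \<kappa> (Poly_Mapping.lookup p w) else 0) =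
      (\<lambda>w. \<kappa> (Poly_Mapping.lookup p w))"
    by (auto simp: fun_eq_iff in_keys_iff \<kappa>.C_zero)
  ultimately show ?thesis by simp
qed

lemma \<kappa>_eq_0D:
  assumes "\<kappa> c = 0"
  shows "c = 0"
proof (rule ccontr)
  assume "c \<noteq> 0"
  then have "\<kappa> c * \<kappa> (inverse c) = 1" by (simp add: \<kappa>.C_one flip: \<kappa>.C_mult)
  with assms show False by simp
qed

text \<open>Multiplied by \<open>\<eta>\<close>, a relation among monomials becomes a combination of
  words equal to a skew polynomial, namely zero; its coefficients vanish, and
  \<open>\<kappa>\<close> is injective.\<close>

lemma eval_free_eq_0D:
  assumes "Poly_Mapping.keys p \<subseteq> lists S" "eval_free p = \<zero>"
  shows "p = 0"
proof (rule poly_mapping_eqI)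
  have "combination (\<lambda>w. \<kappa> (Poly_Mapping.lookup p w)) (\<phi> 0)"
    using combination_eval_free[OF assms(1)] assms(2) by (simp add: \<phi>_zero)
  then have "\<kappa> (Poly_Mapping.lookup p w) = 0" for w
    by (rule combination_eq_zero)
  then show "Poly_Mapping.lookup p w = Poly_Mapping.lookup 0 w" for w
    using \<kappa>_eq_0D by simp
qed

section \<open>The image as a subalgebra isomorphic to the free algebra\<close>

lemma free_algebra_simps [simp]:
  "carrier (free_algebra T) = {p. Poly_Mapping.keys p \<subseteq> lists T}"
  "monoid.mult (free_algebra T) = free_mult"
  "one (free_algebra T) = Poly_Mapping.single [] 1"
  "add (free_algebra T) = (+)"
  by (simp_all add: free_algebra_def)

lemma keys_free_mult:
  assumes "Poly_Mapping.keys p \<subseteq> lists T" "Poly_Mapping.keys q \<subseteq> lists T"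
  shows "Poly_Mapping.keys (free_mult p q) \<subseteq> lists T"
proof -
  have "Poly_Mapping.keys (free_mult p q) \<subseteq>
      (\<Union>u\<in>Poly_Mapping.keys p. \<Union>v\<in>Poly_Mapping.keys q. {u @ v})"
    unfolding free_mult_def
    by (intro order.trans[OF keys_sum] UN_mono order.refl) simp
  then show ?thesis using assms by fastforce
qed

abbreviation range_eval_free :: "'a set" where
  "range_eval_free \<equiv> eval_free ` carrier (free_algebra S)"

lemma eval_free_minus: "eval_free (- p) = \<ominus> eval_free p"
  using eval_free_add[of "- p" p] by (simp add: eval_free_zero minus_equality)

lemma eval_free_scalar: "eval_free (Poly_Mapping.single [] c) = const (\<kappa> c)"
  by (simp add: eval_free_single)

lemma subring_eval_free: "subring range_eval_free D"
proof (rule subringI)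
  show "\<one> \<in> range_eval_free"
    by (rule image_eqI[of _ _ "Poly_Mapping.single [] 1"])
      (simp_all add: eval_free_scalar \<kappa>.C_one const_one)
  show "\<ominus> h \<in> range_eval_free" if h: "h \<in> range_eval_free" for h
  proof -
    obtain p where "h = eval_free p" "Poly_Mapping.keys p \<subseteq> lists S" using h by auto
    then show ?thesis
      by (intro image_eqI[of _ _ "- p"]) (simp_all add: eval_free_minus)
  qed
  fix h1 h2 assume "h1 \<in> range_eval_free" "h2 \<in> range_eval_free"
  then obtain p q where pq: "h1 = eval_free p" "Poly_Mapping.keys p \<subseteq> lists S"
      "h2 = eval_free q" "Poly_Mapping.keys q \<subseteq> lists S"
    by auto
  show "h1 \<otimes> h2 \<in> range_eval_free"
    by (rule image_eqI[of _ _ "free_mult p q"]) (simp_all add: pq eval_free_mult keys_free_mult)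
  have "Poly_Mapping.keys (p + q) \<subseteq> lists S"
    using Poly_Mapping.keys_add[of p q] pq by blast
  then show "h1 \<oplus> h2 \<in> range_eval_free"
    by (intro image_eqI[of _ _ "p + q"]) (simp_all add: pq eval_free_add)
qed auto

lemma subalgebra_eval_free: "subalgebra (range (\<lambda>c. const (\<kappa> c))) range_eval_free D"
proof -
  interpret A: subring range_eval_free D by (rule subring_eval_free)
  have "const (\<kappa> c) \<in> range_eval_free" for c
    by (rule image_eqI[of _ _ "Poly_Mapping.single [] c"]) (simp_all add: eval_free_scalar)
  then have "subalgebra_axioms (range (\<lambda>c. const (\<kappa> c))) range_eval_free D"
    unfolding subalgebra_axioms_def using A.m_closed by blast
  then show ?thesis by (intro subalgebra.intro A.subgroup_axioms)
qed

lemma eval_free_ring_iso: "eval_free \<in> ring_iso (free_algebra S) (D\<lparr>carrier := range_eval_free\<rparr>)"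
proof -
  have "inj_on eval_free (carrier (free_algebra S))"
  proof (rule inj_onI)
    fix p q assume "p \<in> carrier (free_algebra S)" "q \<in> carrier (free_algebra S)"
      and eq: "eval_free p = eval_free q"
    then have "Poly_Mapping.keys p \<subseteq> lists S" "Poly_Mapping.keys q \<subseteq> lists S" by simp_all
    then have "Poly_Mapping.keys (p - q) \<subseteq> lists S" using keys_diff[of p q] by blast
    moreover have "eval_free (p - q) = \<zero>"
      using eval_free_add[of p "- q"] eq by (simp add: eval_free_minus r_neg)
    ultimately have "p - q = 0" by (rule eval_free_eq_0D)
    then show "p = q" by simp
  qed
  moreover have "eval_free \<in> ring_hom (free_algebra S) (D\<lparr>carrier := range_eval_free\<rparr>)"
    by (rule ring_hom_memI)
      (simp_all add: eval_free_mult eval_free_add eval_free_scalar \<kappa>.C_one const_one)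
  ultimately show ?thesis by (simp add: ring_iso_def bij_betw_def)
qed

end

theorem theorem1p4:
  fixes \<sigma> :: "('n::{finite,linorder}, 'f::field) rat_functions \<Rightarrow> ('n, 'f) rat_functions"
    and D :: "('d, 'e) ring_scheme"
    and \<phi> :: "('n, 'f) rat_functions poly \<Rightarrow> 'd"
  assumes "\<sigma> \<in> algebra_automorphisms rat_const"
    and "infinite_order \<sigma>"
    and "\<exists>\<tau>\<in>algebra_automorphisms (poly_const :: 'f \<Rightarrow> ('n, 'f) polynomials).
           \<forall>p. \<sigma> (to_fract p) = to_fract (\<tau> p)"
    and "division_ring_of_fractions (skew_poly_ring \<sigma>) D \<phi>"
  shows "\<exists>A. noncommutative_free_subalgebra (\<lambda>c::'f. \<phi> [:rat_const c:]) A D"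
proof -
  obtain a b where independent:
    "\<And>u e e'. \<sigma> e = e \<Longrightarrow> \<sigma> e' = e' \<Longrightarrow> \<sigma> u - u = e * a + e' * b \<Longrightarrow> e = 0 \<and> e' = 0"
    using ex_independent_mod_coboundaries[OF assms(1,2)] assms(3) by metis
  have "skew_field D \<sigma> \<phi>"
    using assms(4) algebra_automorphismsD(1)[OF assms(1)]
    by (simp add: skew_field_def skew_field_axioms_def division_ring_of_fractions_def skew_poly_ring_def)
  then interpret skew_field D \<sigma> \<phi> .
  have "\<zero>\<^bsub>D\<^esub> \<noteq> \<one>\<^bsub>D\<^esub>"
    using \<phi>_inj by (metis \<phi>_one \<phi>_zero inj_eq zero_neq_one)
  define \<alpha> where "\<alpha> x = (if x = \<zero>\<^bsub>D\<^esub> then a else b)" for x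
  \<comment> \<open>Only the cardinality of the alphabet matters.\<close>
  define S where "S = {\<zero>\<^bsub>D\<^esub>, \<one>\<^bsub>D\<^esub>}"
  interpret skew_free D \<sigma> \<phi> \<alpha> S "rat_const :: 'f \<Rightarrow> ('n, 'f) rat_functions"
  proof
    show "finite S" by (simp add: S_def)
    \<comment> \<open>Over the two letters, the sum is \<open>a\<close> times the value of
      \<open>e\<close> at zero plus \<open>b\<close> times its value at one, as in
      \<open>independent\<close>.\<close>
    show "e s = 0"
      if "\<And>s. s \<in> S \<Longrightarrow> \<sigma> (e s) = e s" "\<sigma> u - u = (\<Sum>s\<in>S. e s * \<alpha> s)" "s \<in> S" for e u s
      using independent[of "e \<zero>\<^bsub>D\<^esub>" "e \<one>\<^bsub>D\<^esub>" u] that \<open>\<zero>\<^bsub>D\<^esub> \<noteq> \<one>\<^bsub>D\<^esub>\<close>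
      by (auto simp: S_def \<alpha>_def)
  qed (simp_all add: rat_const_def poly_const_simps
      algebra_automorphismsD(2)[OF assms(1), unfolded rat_const_def])
  have "noncommutative_free_subalgebra (\<lambda>c. \<phi> [:rat_const c:]) range_eval_free D"
    unfolding noncommutative_free_subalgebra_def
  proof (intro conjI exI)
    show "subring range_eval_free D" by (rule subring_eval_free)
    show "subalgebra (range (\<lambda>c::'f. \<phi> [:rat_const c:])) range_eval_free D"
      using subalgebra_eval_free by (simp add: const_def)
    show "\<exists>x\<in>S. \<exists>y\<in>S. x \<noteq> y" using \<open>\<zero>\<^bsub>D\<^esub> \<noteq> \<one>\<^bsub>D\<^esub>\<close> by (auto simp: S_def)
    show "eval_free \<in> ring_iso (free_algebra S) (D\<lparr>carrier := range_eval_free\<rparr>)" by (rule eval_free_ring_iso)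
    show "\<forall>c. eval_free (Poly_Mapping.single [] c) = \<phi> [:rat_const c:]"
      by (simp add: eval_free_scalar const_def)
  qed
  then show ?thesis by blast
qed

end
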